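(* The even Weyl group of the hyperbolic Kac--Moody algebra $D_4^{++}$ satisfies $$W^+(D_4^{++})\cong PSL_2^{(0)}(\mathtt{H}),$$ where $\mathtt{H}$ is the ring of Hurwitz quaternions and $$PSL_2^{(0)}(\mathtt{H})=\Big\{S=\begin{pmatrix}a&b\\c&d\end{pmatrix}\in PSL_2(\mathtt{H})\ \Big|\ ad-bc\equiv1\ (\mathrm{mod}\ \mathtt{C})\Big\},$$ with $\mathtt{C}$ the two-sided ideal of $\mathtt{H}$ generated by all commutators.
   Context: For a Kac--Moody algebra with Cartan matrix $[A_{IJ}]$, the Weyl group $W$ is the Coxeter group with generators $w_I$ and relations $w_I^2=1$, $(w_Iw_J)^{m_{IJ}}=1$ for $I\ne J$, where $m_{IJ}=2,3,4,6,\infty$ according as $A_{IJ}A_{JI}=0,1,2,3,\ge4$. $W^+\subset W$ is the index 2 subgroup of products of an even number of generators. $D_4^{++}$ is the over-extension of $D_4$ (the untwisted affine extension with one more node attached by a single line to the affine node). Its nodes are $-1,0,1,2,3,4$, with single edges ($m_{IJ}=3$) exactly $\{-1,0\},\{0,1\},\{1,2\},\{1,3\},\{1,4\}$, and $m_{IJ}=2$ for the other pairs. $\mathtt{H}=\{n_0+n_1i+n_2j+n_3k: \text{all }n_r\in\mathbb{Z}\text{ or all }n_r\in\mathbb{Z}+\tfrac12\}$ is the ring of Hurwitz integers. $\mathtt{C}$ is the two-sided ideal of $\mathtt{H}$ generated by all $ab-ba$, $a,b\in\mathtt{H}$; the quotient $\mathtt{H}/\mathtt{C}$ is the field $\mathbb{F}_4$.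 $SL_2(\mathbb{H})$ is the group of $2\times2$ quaternionic matrices $S$ with $\det(SS^\dagger)=1$, where $S^\dagger$ is the conjugate transpose and the determinant of a Hermitian quaternionic matrix $\begin{pmatrix}p&q\\\bar q&r\end{pmatrix}$ ($p,r\in\mathbb{R}$) is $pr-q\bar q$. $PSL_2(\mathbb{H})=SL_2(\mathbb{H})/\{\pm1\}$, and $PSL_2(\mathtt{H})\subset PSL_2(\mathbb{H})$ is the subgroup of (classes of) matrices with all entries in $\mathtt{H}$. *)

theory Defs
  imports
    "HOL-Algebra.Coset"
    "HOL-Algebra.Ideal"
    "HOL-Analysis.Finite_Cartesian_Product"
    "HOL-Library.Extended_Nat"
begin

section \<open>Groups given by generators and relations\<close>

text \<open>A letter \<open>(x, False)\<close> stands for the generator \<open>x\<close>, a letter \<open>(x, True)\<close> for its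
  formal inverse.\<close>

type_synonym 'g word = "('g \<times> bool) list"

definition words :: "'g set \<Rightarrow> 'g word set" where
  "words S = lists (S \<times> UNIV)"

inductive_set pres_cong :: "'g set \<Rightarrow> 'g word set \<Rightarrow> ('g word \<times> 'g word) set"
  for S :: "'g set" and R :: "'g word set" where
  refl: "u \<in> words S \<Longrightarrow> (u, u) \<in> pres_cong S R"
| sym: "(u, v) \<in> pres_cong S R \<Longrightarrow> (v, u) \<in> pres_cong S R"
| trans: "(u, v) \<in> pres_cong S R \<Longrightarrow> (v, w) \<in> pres_cong S R \<Longrightarrow> (u, w) \<in> pres_cong S R"
| cancel: "u \<in> words S \<Longrightarrow> v \<in> words S \<Longrightarrow> x \<in> S \<Longrightarrow>
    (u @ [(x, b), (x, \<not> b)] @ v, u @ v) \<in> pres_cong S R"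
| relator: "u \<in> words S \<Longrightarrow> v \<in> words S \<Longrightarrow> r \<in> R \<Longrightarrow> r \<in> words S \<Longrightarrow>
    (u @ r @ v, u @ v) \<in> pres_cong S R"

definition presented_group :: "'g set \<Rightarrow> 'g word set \<Rightarrow> 'g word set monoid" where
  "presented_group S R =
    \<lparr>carrier = words S // pres_cong S R,
     mult = (\<lambda>A B. \<Union>u\<in>A. \<Union>v\<in>B. pres_cong S R `` {u @ v}),
     one = pres_cong S R `` {[]}\<rparr>"

definition pres_gen :: "'g set \<Rightarrow> 'g word set \<Rightarrow> 'g \<Rightarrow> 'g word set" where
  "pres_gen S R x = pres_cong S R `` {[(x, False)]}"

lemma words_append [simp]: "u @ v \<in> words S \<longleftrightarrow> u \<in> words S \<and> v \<in> words S"
  by (auto simp: words_def)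

lemma words_Nil [simp]: "[] \<in> words S"
  by (simp add: words_def)

lemma words_inverse: "u \<in> words S \<Longrightarrow> map (apsnd Not) (rev u) \<in> words S"
  by (fastforce simp: words_def in_lists_conv_set)

lemma pres_cong_words:
  "(u, v) \<in> pres_cong S R \<Longrightarrow> u \<in> words S \<and> v \<in> words S"
  by (induction rule: pres_cong.induct) (auto simp: words_def)

lemma equiv_pres_cong: "equiv (words S) (pres_cong S R)"
proof (rule equivI)
  show "pres_cong S R \<subseteq> words S \<times> words S"
    by (auto dest: pres_cong_words)
  show "refl_on (words S) (pres_cong S R)"
    by (auto intro!: refl_onI pres_cong.refl)
  show "sym (pres_cong S R)"
    by (rule symI) (rule pres_cong.sym)
  show "trans (pres_cong S R)"
    by (rule transI) (rule pres_cong.trans)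
qed

lemma pres_cong_context:
  "(u, v) \<in> pres_cong S R \<Longrightarrow> p \<in> words S \<Longrightarrow> q \<in> words S \<Longrightarrow>
    (p @ u @ q, p @ v @ q) \<in> pres_cong S R"
proof (induction rule: pres_cong.induct)
  case (refl u)
  then show ?case by (simp add: pres_cong.refl)
next
  case (sym u v)
  from pres_cong.sym[OF sym.IH[OF sym.prems]] show ?case .
next
  case (trans u v w)
  from pres_cong.trans[OF trans.IH(1)[OF trans.prems] trans.IH(2)[OF trans.prems]] show ?case .
next
  case (cancel u v x b)
  then show ?case
    using pres_cong.cancel[of "p @ u" S "v @ q" x b R] by simp
next
  case (relator u v r)
  then show ?case
    using pres_cong.relator[of "p @ u" S "v @ q" r R] by simp
qed

lemma pres_cong_append:
  assumes "(u, u') \<in> pres_cong S R" "(v, v') \<in> pres_cong S R"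
  shows "(u @ v, u' @ v') \<in> pres_cong S R"
proof -
  have "(u @ v, u' @ v) \<in> pres_cong S R"
    using pres_cong_context[OF assms(1), of "[]" v] pres_cong_words[OF assms(2)] by simp
  moreover have "(u' @ v, u' @ v') \<in> pres_cong S R"
    using pres_cong_context[OF assms(2), of u' "[]"] pres_cong_words[OF assms(1)] by simp
  ultimately show ?thesis
    by (rule pres_cong.trans)
qed

lemma presented_group_mult:
  assumes "u \<in> words S" "v \<in> words S"
  shows "pres_cong S R `` {u} \<otimes>\<^bsub>presented_group S R\<^esub> pres_cong S R `` {v} =
    pres_cong S R `` {u @ v}"
proof -
  let ?r = "pres_cong S R"
  have class_eq: "?r `` {u' @ v'} = ?r `` {u @ v}" if "u' \<in> ?r `` {u}" "v' \<in> ?r `` {v}" for u' v'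
  proof -
    have "(u, u') \<in> ?r" "(v, v') \<in> ?r"
      using that by simp_all
    from equiv_class_eq[OF equiv_pres_cong pres_cong_append[OF this]] show ?thesis
      by simp
  qed
  have self: "u \<in> ?r `` {u}" "v \<in> ?r `` {v}"
    using assms by (simp_all add: pres_cong.refl)
  have "(\<Union>u'\<in>?r `` {u}. \<Union>v'\<in>?r `` {v}. ?r `` {u' @ v'}) =
      (\<Union>u'\<in>?r `` {u}. \<Union>v'\<in>?r `` {v}. ?r `` {u @ v})"
    by (intro SUP_cong HOL.refl class_eq)
  also have "\<dots> = ?r `` {u @ v}"
    using self by blast
  finally show ?thesis
    unfolding presented_group_def by simp
qed

lemma presented_group_carrierE:
  assumes "X \<in> carrier (presented_group S R)"
  obtains u where "u \<in> words S" "X = pres_cong S R `` {u}"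
  using assms by (auto simp: presented_group_def elim!: quotientE)

lemma presented_group_carrierI:
  "u \<in> words S \<Longrightarrow> pres_cong S R `` {u} \<in> carrier (presented_group S R)"
  by (simp add: presented_group_def quotientI)

lemma pres_cong_inverse:
  "u \<in> words S \<Longrightarrow> (map (apsnd Not) (rev u) @ u, []) \<in> pres_cong S R"
proof (induction u)
  case Nil
  then show ?case by (auto intro: pres_cong.refl)
next
  case (Cons l u)
  obtain x b where l: "l = (x, b)" by force
  have x: "x \<in> S" and u: "u \<in> words S"
    using Cons.prems by (auto simp: l words_def)
  have "map (apsnd Not) (rev u) \<in> words S"
    using u by (rule words_inverse)
  then have "(map (apsnd Not) (rev u) @ [(x, \<not> b), (x, \<not> \<not> b)] @ u,
      map (apsnd Not) (rev u) @ u) \<in> pres_cong S R"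
    using u x by (intro pres_cong.cancel)
  from pres_cong.trans[OF this Cons.IH[OF u]] show ?case
    by (simp add: l)
qed

lemma group_presented_group: "group (presented_group S R)"
proof (rule groupI)
  fix X Y Z
  assume "X \<in> carrier (presented_group S R)" "Y \<in> carrier (presented_group S R)"
    "Z \<in> carrier (presented_group S R)"
  then show "X \<otimes>\<^bsub>presented_group S R\<^esub> Y \<otimes>\<^bsub>presented_group S R\<^esub> Z =
      X \<otimes>\<^bsub>presented_group S R\<^esub> (Y \<otimes>\<^bsub>presented_group S R\<^esub> Z)"
    by (elim presented_group_carrierE) (simp add: presented_group_mult)
next
  fix X Y
  assume "X \<in> carrier (presented_group S R)" "Y \<in> carrier (presented_group S R)"
  then show "X \<otimes>\<^bsub>presented_group S R\<^esub> Y \<in> carrier (presented_group S R)"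
    by (elim presented_group_carrierE) (simp add: presented_group_mult presented_group_carrierI)
next
  show "\<one>\<^bsub>presented_group S R\<^esub> \<in> carrier (presented_group S R)"
    by (simp add: presented_group_def quotientI)
next
  fix X assume "X \<in> carrier (presented_group S R)"
  then obtain u where u: "u \<in> words S" and X: "X = pres_cong S R `` {u}"
    by (rule presented_group_carrierE)
  have one: "\<one>\<^bsub>presented_group S R\<^esub> = pres_cong S R `` {[]}"
    by (simp add: presented_group_def)
  show "\<one>\<^bsub>presented_group S R\<^esub> \<otimes>\<^bsub>presented_group S R\<^esub> X = X"
    using u by (simp add: one X presented_group_mult)
  let ?v = "map (apsnd Not) (rev u)"
  have v: "?v \<in> words S"
    using u by (rule words_inverse)
  have "pres_cong S R `` {?v} \<otimes>\<^bsub>presented_group S R\<^esub> X = \<one>\<^bsub>presented_group S R\<^esub>"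
    using equiv_class_eq[OF equiv_pres_cong pres_cong_inverse[OF u]]
    by (simp add: one X presented_group_mult u v)
  moreover have "pres_cong S R `` {?v} \<in> carrier (presented_group S R)"
    using v by (rule presented_group_carrierI)
  ultimately show "\<exists>Y\<in>carrier (presented_group S R).
      Y \<otimes>\<^bsub>presented_group S R\<^esub> X = \<one>\<^bsub>presented_group S R\<^esub>"
    by blast
qed


section \<open>Weyl groups and their even subgroups\<close>

definition coxeter_m :: "('i \<Rightarrow> 'i \<Rightarrow> int) \<Rightarrow> 'i \<Rightarrow> 'i \<Rightarrow> enat" where
  "coxeter_m A I J =
    (if A I J * A J I = 0 then 2
     else if A I J * A J I = 1 then 3
     else if A I J * A J I = 2 then 4
     else if A I J * A J I = 3 then 6
     else \<infinity>)"

text \<open>A pair with \<open>coxeter_m A I J = \<infinity>\<close> contributes no relator.\<close>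

definition weyl_relators :: "'i set \<Rightarrow> ('i \<Rightarrow> 'i \<Rightarrow> int) \<Rightarrow> 'i word set" where
  "weyl_relators S A =
    {[(I, False), (I, False)] | I. I \<in> S} \<union>
    {concat (replicate m [(I, False), (J, False)]) | I J m.
       I \<in> S \<and> J \<in> S \<and> I \<noteq> J \<and> coxeter_m A I J = enat m}"

definition weyl_group :: "'i set \<Rightarrow> ('i \<Rightarrow> 'i \<Rightarrow> int) \<Rightarrow> 'i word set monoid" where
  "weyl_group S A = presented_group S (weyl_relators S A)"

definition weyl_gen :: "'i set \<Rightarrow> ('i \<Rightarrow> 'i \<Rightarrow> int) \<Rightarrow> 'i \<Rightarrow> 'i word set" where
  "weyl_gen S A I = pres_gen S (weyl_relators S A) I"

definition even_weyl_group :: "'i set \<Rightarrow> ('i \<Rightarrow> 'i \<Rightarrow> int) \<Rightarrow> 'i word set monoid" where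
  "even_weyl_group S A = (weyl_group S A)
    \<lparr>carrier := {foldr (mult (weyl_group S A)) (map (weyl_gen S A) Is) \<one>\<^bsub>weyl_group S A\<^esub> | Is.
       Is \<in> lists S \<and> even (length Is)}\<rparr>"

definition D4pp_nodes :: "int set" where
  "D4pp_nodes = {-1, 0, 1, 2, 3, 4}"

definition D4pp_edges :: "int set set" where
  "D4pp_edges = {{-1, 0}, {0, 1}, {1, 2}, {1, 3}, {1, 4}}"

definition D4pp_cartan :: "int \<Rightarrow> int \<Rightarrow> int" where
  "D4pp_cartan I J = (if I = J then 2 else if {I, J} \<in> D4pp_edges then -1 else 0)"


section \<open>Quaternions\<close>

datatype quat = Quat (qRe: real) (qIm1: real) (qIm2: real) (qIm3: real)

instantiation quat :: ring_1
begin

definition zero_quat :: quat where "0 = Quat 0 0 0 0"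

definition one_quat :: quat where "1 = Quat 1 0 0 0"

definition plus_quat :: "quat \<Rightarrow> quat \<Rightarrow> quat" where
  "p + q = Quat (qRe p + qRe q) (qIm1 p + qIm1 q) (qIm2 p + qIm2 q) (qIm3 p + qIm3 q)"

definition uminus_quat :: "quat \<Rightarrow> quat" where
  "- q = Quat (- qRe q) (- qIm1 q) (- qIm2 q) (- qIm3 q)"

definition minus_quat :: "quat \<Rightarrow> quat \<Rightarrow> quat" where
  "p - q = Quat (qRe p - qRe q) (qIm1 p - qIm1 q) (qIm2 p - qIm2 q) (qIm3 p - qIm3 q)"

definition times_quat :: "quat \<Rightarrow> quat \<Rightarrow> quat" where
  "p * q = Quat
     (qRe p * qRe q - qIm1 p * qIm1 q - qIm2 p * qIm2 q - qIm3 p * qIm3 q)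
     (qRe p * qIm1 q + qIm1 p * qRe q + qIm2 p * qIm3 q - qIm3 p * qIm2 q)
     (qRe p * qIm2 q - qIm1 p * qIm3 q + qIm2 p * qRe q + qIm3 p * qIm1 q)
     (qRe p * qIm3 q + qIm1 p * qIm2 q - qIm2 p * qIm1 q + qIm3 p * qRe q)"

instance
  by standard
    (simp_all add: zero_quat_def one_quat_def plus_quat_def uminus_quat_def
      minus_quat_def times_quat_def algebra_simps)

end

definition qcnj :: "quat \<Rightarrow> quat" where
  "qcnj q = Quat (qRe q) (- qIm1 q) (- qIm2 q) (- qIm3 q)"


section \<open>Hurwitz integers and the commutator ideal\<close>

definition hurwitz :: "quat set" where
  "hurwitz = {q. (\<forall>x\<in>{qRe q, qIm1 q, qIm2 q, qIm3 q}. x \<in> \<int>) \<or>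
                 (\<forall>x\<in>{qRe q, qIm1 q, qIm2 q, qIm3 q}. x - 1 / 2 \<in> \<int>)}"

definition hurwitz_ring :: "quat ring" where
  "hurwitz_ring = \<lparr>carrier = hurwitz, mult = (*), one = 1, zero = 0, add = (+)\<rparr>"

lemma hurwitz_iff:
  "q \<in> hurwitz \<longleftrightarrow> (\<exists>s a b c d. q = Quat (of_int s / 2 + of_int a)
    (of_int s / 2 + of_int b) (of_int s / 2 + of_int c) (of_int s / 2 + of_int d))"
    (is "_ \<longleftrightarrow> ?R")
proof
  assume "q \<in> hurwitz"
  then consider
      a b c d :: int where "q = Quat (of_int a) (of_int b) (of_int c) (of_int d)"
    | a b c d :: int where "qRe q - 1 / 2 = a" "qIm1 q - 1 / 2 = b" "qIm2 q - 1 / 2 = c"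
        "qIm3 q - 1 / 2 = d"
    unfolding hurwitz_def by (cases q) (auto elim!: Ints_cases)
  then show ?R
  proof cases
    case (1 a b c d)
    then show ?thesis by (intro exI[of _ 0] exI[of _ a] exI[of _ b] exI[of _ c] exI[of _ d]) simp
  next
    case (2 a b c d)
    then show ?thesis
      by (intro exI[of _ 1] exI[of _ a] exI[of _ b] exI[of _ c] exI[of _ d])
        (simp add: quat.expand)
  qed
next
  assume ?R
  then obtain s a b c d :: int
    where q: "q = Quat (s / 2 + a) (s / 2 + b) (s / 2 + c) (s / 2 + d)" by blast
  obtain t where "s = 2 * t \<or> s = 2 * t + 1"
    by (metis oddE evenE)
  then show "q \<in> hurwitz"
  proof
    assume "s = 2 * t"
    then have "q = Quat (of_int (t + a)) (of_int (t + b)) (of_int (t + c)) (of_int (t + d))"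
      by (simp add: q)
    then show ?thesis unfolding hurwitz_def by (simp del: of_int_add)
  next
    assume "s = 2 * t + 1"
    then have "qRe q - 1 / 2 = of_int (t + a)" "qIm1 q - 1 / 2 = of_int (t + b)"
      "qIm2 q - 1 / 2 = of_int (t + c)" "qIm3 q - 1 / 2 = of_int (t + d)"
      by (simp_all add: q field_simps)
    then show ?thesis unfolding hurwitz_def by (simp del: of_int_add)
  qed
qed

lemma hurwitz_zero: "0 \<in> hurwitz" and hurwitz_one: "1 \<in> hurwitz"
  by (simp_all add: hurwitz_def zero_quat_def one_quat_def)

lemma hurwitz_add:
  assumes "p \<in> hurwitz" "q \<in> hurwitz"
  shows "p + q \<in> hurwitz"
proof -
  obtain s a b c d t e f g h :: int
    where p: "p = Quat (s / 2 + a) (s / 2 + b) (s / 2 + c) (s / 2 + d)"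
      and q: "q = Quat (t / 2 + e) (t / 2 + f) (t / 2 + g) (t / 2 + h)"
    using assms unfolding hurwitz_iff by blast
  show ?thesis
    unfolding hurwitz_iff
    by (rule exI[of _ "s + t"], rule exI[of _ "a + e"], rule exI[of _ "b + f"],
        rule exI[of _ "c + g"], rule exI[of _ "d + h"])
      (simp add: p q plus_quat_def field_simps)
qed

lemma hurwitz_uminus:
  assumes "p \<in> hurwitz"
  shows "- p \<in> hurwitz"
proof -
  obtain s a b c d :: int
    where p: "p = Quat (s / 2 + a) (s / 2 + b) (s / 2 + c) (s / 2 + d)"
    using assms unfolding hurwitz_iff by blast
  show ?thesis
    unfolding hurwitz_iff
    by (rule exI[of _ "- s"], rule exI[of _ "- a"], rule exI[of _ "- b"],
        rule exI[of _ "- c"], rule exI[of _ "- d"])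
      (simp add: p uminus_quat_def field_simps)
qed

lemma hurwitz_mult:
  assumes "p \<in> hurwitz" "q \<in> hurwitz"
  shows "p * q \<in> hurwitz"
proof -
  obtain s a b c d t e f g h :: int
    where p: "p = Quat (s / 2 + a) (s / 2 + b) (s / 2 + c) (s / 2 + d)"
      and q: "q = Quat (t / 2 + e) (t / 2 + f) (t / 2 + g) (t / 2 + h)"
    using assms unfolding hurwitz_iff by blast
  show ?thesis
    unfolding hurwitz_iff
    by (rule exI[of _ "s * t + s * (e + f + g + h) + t * (a + b + c + d)"],
        rule exI[of _ "a * e - b * f - c * g - d * h - s * t - s * (f + g + h) - t * (b + c + d)"],
        rule exI[of _ "a * f + b * e + c * h - d * g - s * g - t * d"],
        rule exI[of _ "a * g - b * h + c * e + d * f - s * h - t * b"],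
        rule exI[of _ "a * h + b * g - c * f + d * e - s * f - t * c"])
      (simp add: p q times_quat_def field_simps)
qed

lemma ring_hurwitz_ring: "ring hurwitz_ring"
proof (rule ringI)
  show "abelian_group hurwitz_ring"
  proof (rule abelian_groupI)
    show "\<exists>y\<in>carrier hurwitz_ring. y \<oplus>\<^bsub>hurwitz_ring\<^esub> x = \<zero>\<^bsub>hurwitz_ring\<^esub>"
      if "x \<in> carrier hurwitz_ring" for x
      using that by (intro bexI[of _ "- x"]) (auto simp: hurwitz_ring_def hurwitz_uminus)
  qed (auto simp: hurwitz_ring_def hurwitz_add hurwitz_zero algebra_simps)
  show "monoid hurwitz_ring"
    by (rule monoidI) (auto simp: hurwitz_ring_def hurwitz_mult hurwitz_one mult.assoc)
qed (auto simp: hurwitz_ring_def distrib_left distrib_right)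

definition commutator_ideal :: "quat set" where
  "commutator_ideal = Idl\<^bsub>hurwitz_ring\<^esub> {a * b - b * a | a b. a \<in> hurwitz \<and> b \<in> hurwitz}"


section \<open>Quaternionic special linear groups\<close>

definition ctranspose :: "quat^2^2 \<Rightarrow> quat^2^2" where
  "ctranspose S = (\<chi> i j. qcnj (S $ j $ i))"

text \<open>Only used for Hermitian matrices, where the value is a real quaternion.\<close>

definition herm_det :: "quat^2^2 \<Rightarrow> quat" where
  "herm_det M = M $ 1 $ 1 * M $ 2 $ 2 - M $ 1 $ 2 * qcnj (M $ 1 $ 2)"

definition SL2_quat :: "(quat^2^2) monoid" where
  "SL2_quat = \<lparr>carrier = {S. herm_det (S ** ctranspose S) = 1}, mult = (**), one = mat 1\<rparr>"

definition PSL2_quat :: "(quat^2^2) set monoid" where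
  "PSL2_quat = SL2_quat Mod {mat 1, - mat 1}"

definition PSL2_hurwitz :: "(quat^2^2) set monoid" where
  "PSL2_hurwitz = PSL2_quat
    \<lparr>carrier := {{mat 1, - mat 1} #>\<^bsub>SL2_quat\<^esub> S | S.
       S \<in> carrier SL2_quat \<and> (\<forall>i j. S $ i $ j \<in> hurwitz)}\<rparr>"

text \<open>The condition does not depend on the representative, as replacing \<open>S\<close> by \<open>- S\<close> leaves
  \<open>a d - b c\<close> unchanged.\<close>

definition PSL2_0_hurwitz :: "(quat^2^2) set monoid" where
  "PSL2_0_hurwitz = PSL2_hurwitz
    \<lparr>carrier := {X \<in> carrier PSL2_hurwitz.
       \<exists>S\<in>X. (S $ 1 $ 1 * S $ 2 $ 2 - S $ 1 $ 2 * S $ 2 $ 1) - 1 \<in> commutator_ideal}\<rparr>"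

end

theory Submission
  imports Defs "HOL-Analysis.Cartesian_Space"
begin

text \<open>A Hermitian quaternionic matrix with rows \<open>(p, z)\<close> and \<open>(qcnj z, r)\<close> is written as the vector
\<open>v = (p, r, z)\<close>; minus twice its determinant is the Lorentzian form \<open>lorentz_form v v\<close>. In this
six-dimensional space there are six vectors whose Gram matrix is the Cartan matrix of \<open>D\<^sub>4\<^sup>+\<^sup>+\<close>, so the
Weyl group acts by reflections. On the other side a matrix \<open>S\<close> acts by \<open>X \<mapsto> S X S\<^sup>\<dagger>\<close>. The
isomorphism sends an even Weyl group element to the set of all matrices that act in the same way.
Three things have to be shown.

The reflection representation is faithful (\<open>act_eq_iff\<close>). This is the classical argument of Tits: if
right multiplication by the generator \<open>I\<close> makes \<open>u\<close> longer, then \<open>u\<close> maps the simple root of \<open>I\<close> to a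
positive root. For a simply laced diagram the dihedral subgroups have order 4 or 6 and can be treated
by hand, and positivity can be measured by one linear functional, the height.

Every even element is induced by a matrix over the Hurwitz integers with \<open>a d - b c\<close> congruent to 1,
and this matrix is unique up to sign (\<open>even_word_induces\<close>, \<open>induces_id_imp\<close>). A single reflection
reverses orientation and is not of the form \<open>X \<mapsto> S X S\<^sup>\<dagger>\<close>, but its product with the reflection
\<open>sigma\<close> in the highest root of \<open>D\<^sub>4\<close> is; two reflections are the product of two such factors, as
\<open>sigma\<close> is an involution.

Every matrix in question occurs (\<open>hurwitz_det_one_even_image\<close>). The Euclidean algorithm in the Hurwitz
ring reduces it, by unipotent matrices and the Weyl element, to a triangular matrix with units \<open>a\<close>,
\<open>d\<close> on the diagonal, \<open>a d\<close> congruent to 1. Units congruent to 1 are the eight elements \<open>\<plusminus>1\<close>, \<open>\<plusminus>i\<close>,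
\<open>\<plusminus>j\<close>, \<open>\<plusminus>k\<close>, because elements of the commutator ideal have integral coordinates; the matching
diagonal matrices and all unipotent ones are products of those attached to the simple reflections.
That the determinant condition survives each step is the multiplicativity of \<open>a d - b c\<close> modulo the
commutator ideal (\<open>hurwitz_det_one_mult\<close>).\<close>

section \<open>Faithfulness of the reflection representation of a simply laced Weyl group\<close>

text \<open>The functional \<open>height\<close> takes over the role that the cone spanned by the simple roots plays in the
usual account: of positivity one needs only that sums of positive vectors are positive, that \<open>v\<close> and
\<open>- v\<close> are not both positive, and that simple roots are positive.\<close>

locale simply_laced_roots =
  fixes S :: "'i set" and A :: "'i \<Rightarrow> 'i \<Rightarrow> int"
    and form :: "'v::real_vector \<Rightarrow> 'v \<Rightarrow> real"
    and root :: "'i \<Rightarrow> 'v" and height :: "'v \<Rightarrow> real"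
  assumes linear_form: "linear (form x)"
    and form_sym: "form x y = form y x"
    and form_root: "I \<in> S \<Longrightarrow> J \<in> S \<Longrightarrow> form (root I) (root J) = of_int (A I J)"
    and cartan_diag: "I \<in> S \<Longrightarrow> A I I = 2"
    and cartan_off_diag: "I \<in> S \<Longrightarrow> J \<in> S \<Longrightarrow> I \<noteq> J \<Longrightarrow> A I J = 0 \<or> A I J = -1"
    and linear_height: "linear height"
    and height_root: "I \<in> S \<Longrightarrow> height (root I) > 0"
begin

definition refl :: "'i \<Rightarrow> 'v \<Rightarrow> 'v" where
  "refl I x = x - form x (root I) *\<^sub>R root I"

text \<open>Formal inverses act like the generators themselves, since reflections are involutions.\<close>

definition act :: "'i word \<Rightarrow> 'v \<Rightarrow> 'v" where
  "act u = foldr (\<lambda>l. refl (fst l)) u"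

abbreviation weyl_cong :: "('i word \<times> 'i word) set" where
  "weyl_cong \<equiv> pres_cong S (weyl_relators S A)"

abbreviation gen :: "'i \<Rightarrow> 'i word" where
  "gen I \<equiv> [(I, False)]"

lemma form_arith:
  "form (x + y) z = form x z + form y z" "form x (y + z) = form x y + form x z"
  "form (x - y) z = form x z - form y z" "form x (y - z) = form x y - form x z"
  "form (c *\<^sub>R x) z = c * form x z" "form x (c *\<^sub>R z) = c * form x z"
  using linear_form[of x] linear_form[of z] form_sym[of "x + y" z] form_sym[of "x - y" z]
    form_sym[of "c *\<^sub>R x" z] form_sym[of x z] form_sym[of y z]
  by (simp_all only: linear_add linear_diff linear_cmul real_scaleR_def)

lemma cartan_sym:
  assumes "I \<in> S" "J \<in> S"
  shows "A I J = A J I"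
  using form_root[OF assms] form_root[OF assms(2,1)] form_sym by (metis of_int_eq_iff)

lemma linear_refl: "linear (refl I)"
  by (rule linearI) (simp_all add: refl_def form_arith algebra_simps)

lemma act_Nil [simp]: "act [] x = x"
  and act_Cons [simp]: "act (l # u) x = refl (fst l) (act u x)"
  and act_append [simp]: "act (u @ w) x = act u (act w x)"
  by (simp_all add: act_def)

lemma linear_act: "linear (act u)"
proof (induction u)
  case Nil
  then show ?case by (simp add: linear_iff)
next
  case (Cons l u)
  then show ?case
    using linear_compose[OF Cons linear_refl[of "fst l"]] by (simp add: o_def act_def)
qed

lemma refl_root:
  assumes "I \<in> S" "J \<in> S"
  shows "refl I (root J) = root J - of_int (A I J) *\<^sub>R root I"
  using form_root[OF assms(2,1)] cartan_sym[OF assms] by (simp add: refl_def)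

lemma refl_root_self: "I \<in> S \<Longrightarrow> refl I (root I) = - root I"
  by (simp add: refl_root cartan_diag scaleR_2)

lemma refl_refl: "I \<in> S \<Longrightarrow> refl I (refl I x) = x"
  by (simp add: refl_def form_arith form_root cartan_diag algebra_simps flip: scaleR_2)

lemma form_refl: "I \<in> S \<Longrightarrow> form (refl I x) (refl I y) = form x y"
  using form_sym[of x "root I"] form_sym[of y "root I"]
  by (simp add: refl_def form_arith form_root cartan_diag algebra_simps)

lemma form_act: "u \<in> words S \<Longrightarrow> form (act u x) (act u y) = form x y"
  by (induction u) (auto simp: form_refl words_def)

lemma refl_commute:
  assumes "I \<in> S" "J \<in> S" "A I J = 0"
  shows "refl I (refl J x) = refl J (refl I x)"
  using assms cartan_sym[of I J] by (simp add: refl_def form_arith form_root algebra_simps)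

lemma refl_braid:
  assumes "I \<in> S" "J \<in> S" "A I J = -1"
  shows "refl I (refl J (refl I x)) = refl J (refl I (refl J x))"
  using assms cartan_sym[of I J]
  by (simp add: refl_def form_arith form_root cartan_diag algebra_simps)

lemma coxeter_m_cases:
  assumes "I \<in> S" "J \<in> S" "I \<noteq> J" "coxeter_m A I J = enat m"
  shows "A I J = 0 \<and> m = 2 \<or> A I J = -1 \<and> m = 3"
  using assms(4) cartan_off_diag[OF assms(1-3)] cartan_sym[OF assms(1,2)]
  by (auto simp: coxeter_m_def numeral_eq_enat)

lemma act_relator:
  assumes "w \<in> weyl_relators S A"
  shows "act w x = x"
  using assms unfolding weyl_relators_def
proof (elim UnE)
  assume "w \<in> {[(I, False), (I, False)] |I. I \<in> S}"
  then show ?thesis by (auto simp: refl_refl)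
next
  assume "w \<in> {concat (replicate m [(I, False), (J, False)]) |I J m.
       I \<in> S \<and> J \<in> S \<and> I \<noteq> J \<and> coxeter_m A I J = enat m}"
  then obtain I J m where w: "w = concat (replicate m [(I, False), (J, False)])"
    and IJ: "I \<in> S" "J \<in> S" "I \<noteq> J" "coxeter_m A I J = enat m" by blast
  from coxeter_m_cases[OF IJ] show ?thesis
  proof (elim disjE conjE)
    assume "A I J = 0" "m = 2"
    then show ?thesis
      using IJ by (simp add: w numeral_2_eq_2 refl_commute[of I J] refl_refl)
  next
    assume A: "A I J = -1" and m: "m = 3"
    have "act w x = refl I (refl J (refl I (refl J (refl I (refl J x)))))"
      by (simp add: w m numeral_3_eq_3)
    also have "\<dots> = x"
      using IJ A by (simp add: refl_braid[of I J, symmetric] refl_refl)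
    finally show ?thesis .
  qed
qed

lemma act_cong: "(u, v) \<in> weyl_cong \<Longrightarrow> act u = act v"
proof (induction rule: pres_cong.induct)
  case (cancel u v x b)
  then show ?case by (simp add: fun_eq_iff refl_refl)
next
  case (relator u v r)
  then show ?case by (simp add: fun_eq_iff act_relator)
qed simp_all

lemma parity_cong: "(u, v) \<in> weyl_cong \<Longrightarrow> even (length u) = even (length v)"
proof (induction rule: pres_cong.induct)
  case (relator u v r)
  have "length (concat (replicate m [a, b])) = 2 * m" for m and a b :: "'i \<times> bool"
    by (induction m) auto
  then have "even (length r)"
    using relator(3) by (auto simp: weyl_relators_def)
  then show ?case by simp
qed simp_all

lemma gen_words [simp]: "[(I, b)] \<in> words S \<longleftrightarrow> I \<in> S"
  "(I, b) # u \<in> words S \<longleftrightarrow> I \<in> S \<and> u \<in> words S"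
  by (auto simp: words_def)

lemma cong_trans [trans]:
  "(u, v) \<in> weyl_cong \<Longrightarrow> (v, w) \<in> weyl_cong \<Longrightarrow> (u, w) \<in> weyl_cong"
  by (rule pres_cong.trans)

lemma cong_left: "(v, w) \<in> weyl_cong \<Longrightarrow> u \<in> words S \<Longrightarrow> (u @ v, u @ w) \<in> weyl_cong"
  using pres_cong_append pres_cong.refl by metis

lemma cong_right: "(v, w) \<in> weyl_cong \<Longrightarrow> u \<in> words S \<Longrightarrow> (v @ u, w @ u) \<in> weyl_cong"
  using pres_cong_append pres_cong.refl by metis

lemma square_cong: "I \<in> S \<Longrightarrow> (gen I @ gen I, []) \<in> weyl_cong"
  using pres_cong.relator[of "[]" S "[]" "gen I @ gen I" "weyl_relators S A"]
  by (auto simp: weyl_relators_def)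

lemma letter_cong:
  assumes "I \<in> S"
  shows "([(I, b)], gen I) \<in> weyl_cong"
proof (cases b)
  case True
  have "([(I, True)], [(I, True)] @ gen I @ gen I) \<in> weyl_cong"
    using cong_left[OF square_cong[OF assms], of "[(I, True)]"] assms
    by (simp add: pres_cong.sym)
  also have "([(I, True)] @ gen I @ gen I, gen I) \<in> weyl_cong"
    using pres_cong.cancel[of "[]" S "gen I" I True] assms by simp
  finally show ?thesis using True by simp
qed (use assms in \<open>simp add: pres_cong.refl\<close>)

lemma inverse_word_involution: "map (apsnd Not) (rev (map (apsnd Not) (rev w))) = w"
  by (induction w) auto

text \<open>Turns a Coxeter relator into its commutation or braid law: the two sides of the law share an inverse,
one side by the relator and the other by cancelling equal letters from the middle outwards.\<close>

lemma cong_common_inverse: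
  assumes "(u @ w, []) \<in> weyl_cong" "(v @ w, []) \<in> weyl_cong"
  shows "(u, v) \<in> weyl_cong"
proof -
  let ?w = "map (apsnd Not) (rev w)"
  have words: "u \<in> words S" "v \<in> words S" "w \<in> words S"
    using assms by (auto dest: pres_cong_words)
  have inv: "(w @ ?w, []) \<in> weyl_cong"
    using pres_cong_inverse[OF words_inverse[OF words(3)]] by (simp only: inverse_word_involution)
  have "(x, ?w) \<in> weyl_cong" if "(x @ w, []) \<in> weyl_cong" "x \<in> words S" for x
  proof -
    have "(x, x @ w @ ?w) \<in> weyl_cong"
      using cong_left[OF inv that(2)] by (simp add: pres_cong.sym)
    also have "(x @ w @ ?w, ?w) \<in> weyl_cong"
      using cong_right[OF that(1) words_inverse[OF words(3)]] by simp
    finally show ?thesis .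
  qed
  from this[OF assms(1) words(1)] this[OF assms(2) words(2)] show ?thesis
    by (blast intro: pres_cong.trans pres_cong.sym)
qed

lemma reverse_cong: "u \<in> lists (S \<times> {False}) \<Longrightarrow> (u @ rev u, []) \<in> weyl_cong"
proof (induction u)
  case Nil
  then show ?case by (simp add: pres_cong.refl)
next
  case (Cons l u)
  then obtain I where l: "l = (I, False)" "I \<in> S" by auto
  have "([l] @ (u @ rev u) @ [l], [l] @ [] @ [l]) \<in> weyl_cong"
    using Cons l by (intro pres_cong_context) auto
  also have "([l] @ [] @ [l], []) \<in> weyl_cong"
    using square_cong[OF l(2)] l by simp
  finally show ?case by simp
qed

lemma relator_cong:
  assumes "I \<in> S" "J \<in> S" "I \<noteq> J" "coxeter_m A I J = enat m"
  shows "(concat (replicate m [(I, False), (J, False)]), []) \<in> weyl_cong"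
proof -
  let ?w = "concat (replicate m [(I, False), (J, False)])"
  have "?w \<in> weyl_relators S A"
    unfolding weyl_relators_def using assms by blast
  moreover have "?w \<in> words S"
    using assms(1,2) by (induction m) simp_all
  ultimately show ?thesis
    using pres_cong.relator[of "[]" S "[]" ?w "weyl_relators S A"] by simp
qed

lemma commute_cong:
  assumes "I \<in> S" "J \<in> S" "I \<noteq> J" "A I J = 0"
  shows "(gen I @ gen J, gen J @ gen I) \<in> weyl_cong"
proof (rule cong_common_inverse)
  show "((gen I @ gen J) @ gen I @ gen J, []) \<in> weyl_cong"
    using relator_cong[OF assms(1-3), of 2] assms
    by (simp add: coxeter_m_def numeral_eq_enat numeral_2_eq_2)
  show "((gen J @ gen I) @ gen I @ gen J, []) \<in> weyl_cong"
    using reverse_cong[of "gen J @ gen I"] assms by simp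
qed

lemma braid_cong:
  assumes "I \<in> S" "J \<in> S" "I \<noteq> J" "A I J = -1"
  shows "(gen I @ gen J @ gen I, gen J @ gen I @ gen J) \<in> weyl_cong"
proof (rule cong_common_inverse)
  show "((gen I @ gen J @ gen I) @ gen J @ gen I @ gen J, []) \<in> weyl_cong"
    using relator_cong[OF assms(1-3), of 3] assms cartan_sym[of I J]
    by (simp add: coxeter_m_def numeral_eq_enat numeral_3_eq_3)
  show "((gen J @ gen I @ gen J) @ gen J @ gen I @ gen J, []) \<in> weyl_cong"
    using reverse_cong[of "gen J @ gen I @ gen J"] assms by simp
qed

text \<open>The length function of the Coxeter group, on words instead of group elements.\<close>

definition len :: "'i word \<Rightarrow> nat" where
  "len u = (LEAST n. \<exists>v. (u, v) \<in> weyl_cong \<and> length v = n)"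

lemma len_le: "(u, v) \<in> weyl_cong \<Longrightarrow> len u \<le> length v"
  unfolding len_def by (rule Least_le) blast

lemma len_reduced:
  assumes "u \<in> words S"
  obtains v where "(u, v) \<in> weyl_cong" "length v = len u"
proof -
  have "\<exists>v. (u, v) \<in> weyl_cong \<and> length v = len u"
    unfolding len_def by (rule LeastI[of _ "length u"]) (use assms in \<open>blast intro: pres_cong.refl\<close>)
  then show ?thesis using that by blast
qed

lemma len_cong:
  assumes "(u, v) \<in> weyl_cong"
  shows "len u = len v"
proof -
  have "(u, w) \<in> weyl_cong \<longleftrightarrow> (v, w) \<in> weyl_cong" for w
    using assms by (blast intro: pres_cong.trans pres_cong.sym)
  then show ?thesis by (simp add: len_def)
qed

lemma len_append_le:
  assumes "u \<in> words S" "w \<in> words S"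
  shows "len (u @ w) \<le> len u + length w"
proof -
  obtain v where v: "(u, v) \<in> weyl_cong" "length v = len u"
    using len_reduced[OF assms(1)] .
  show ?thesis
    using len_le[OF cong_right[OF v(1) assms(2)]] v(2) by simp
qed

text \<open>All relators have even length, so the parity of a word is an invariant of its class.\<close>

lemma len_snoc_neq:
  assumes "u \<in> words S" "I \<in> S"
  shows "len (u @ gen I) \<noteq> len u"
proof -
  have parity: "even (len w) = even (length w)" if "w \<in> words S" for w
    using len_reduced[OF that] parity_cong by metis
  show ?thesis
    using parity[of u] parity[of "u @ gen I"] assms by auto
qed

lemma reduced_last:
  assumes "u \<in> words S" "len u > 0"
  obtains v I where "v \<in> words S" "I \<in> S" "(u, v @ gen I) \<in> weyl_cong" "len u = len v + 1"
proof -
  obtain u' where u': "(u, u') \<in> weyl_cong" "length u' = len u"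
    using len_reduced[OF assms(1)] .
  then obtain v I b where eq: "u' = v @ [(I, b)]"
    using assms(2) by (cases u' rule: rev_cases) auto
  have v: "v \<in> words S" "I \<in> S"
    using pres_cong_words[OF u'(1)] eq by auto
  have cong: "(u, v @ gen I) \<in> weyl_cong"
    using u'(1) cong_left[OF letter_cong[OF v(2)] v(1)] unfolding eq by (rule pres_cong.trans)
  have "len v \<le> length v"
    using v by (intro len_le pres_cong.refl)
  moreover have "len u \<le> len v + 1"
    using len_append_le[of v "gen I"] len_cong[OF cong] v by simp
  ultimately show ?thesis
    using that[OF v cong] u'(2) eq by simp
qed

text \<open>Induction on the length. Write \<open>u = v J\<close> with \<open>v\<close> shorter; then \<open>J \<noteq> I\<close>. If \<open>v I\<close> is longer than
\<open>v\<close>, then \<open>v\<close> maps the roots of both \<open>I\<close> and \<open>J\<close> to positive vectors, and \<open>J\<close> maps the root of \<open>I\<close> to a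
nonnegative combination of the two. Otherwise \<open>v = x I\<close> with \<open>x\<close> shorter still, so \<open>u = x I J\<close>. If \<open>I\<close>
and \<open>J\<close> commute, \<open>u I = x J\<close> is too short. If they braid, \<open>I J\<close> maps the root of \<open>I\<close> to that of \<open>J\<close>,
and \<open>x J\<close> is longer than \<open>x\<close> because \<open>u I = x J I J\<close> is longer than \<open>u\<close>.\<close>

lemma height_act_root_pos:
  assumes "u \<in> words S" "I \<in> S" "len u < len (u @ gen I)"
  shows "height (act u (root I)) > 0"
  using assms
proof (induction "len u" arbitrary: u I rule: less_induct)
  case less
  note u = less.prems(1) and I = less.prems(2)
  show ?case
  proof (cases "len u = 0")
    case True
    then have cong_Nil: "(u, []) \<in> weyl_cong"
      by (auto intro: len_reduced[OF u])
    then show ?thesis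
      using height_root[OF I] by (simp add: act_cong[OF cong_Nil])
  next
    case False
    then have "len u > 0" by simp
    then obtain v J where v: "v \<in> words S" and J: "J \<in> S"
      and uv: "(u, v @ gen J) \<in> weyl_cong" and len_u: "len u = len v + 1"
      by (rule reduced_last[OF u])
    have act_u: "act u x = act v (refl J x)" for x
      using act_cong[OF uv] by simp
    have uI: "(u @ gen I, v @ gen J @ gen I) \<in> weyl_cong"
      using cong_right[OF uv, of "gen I"] I by simp
    have "J \<noteq> I"
    proof
      assume "J = I"
      have "(v @ gen I @ gen I, v) \<in> weyl_cong"
        using cong_left[OF square_cong[OF I] v] by simp
      with uI have "(u @ gen I, v) \<in> weyl_cong"
        unfolding \<open>J = I\<close> by (rule pres_cong.trans)
      then show False
        using len_cong[of "u @ gen I" v] len_u less.prems(3) by simp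
    qed
    then have A_cases: "A J I = 0 \<or> A J I = -1"
      using cartan_off_diag[OF J I] by blast
    have vJ: "len v < len (v @ gen J)"
      using len_cong[OF uv] len_u by simp
    show ?thesis
    proof (cases "len v < len (v @ gen I)")
      case True
      have "height (act v (root I)) > 0" "height (act v (root J)) > 0"
        using less.hyps[OF _ v I True] less.hyps[OF _ v J vJ] len_u by simp_all
      moreover have "height (act u (root I))
          = height (act v (root I)) - of_int (A J I) * height (act v (root J))"
        by (simp add: act_u refl_root[OF J I] linear_diff[OF linear_act] linear_cmul[OF linear_act]
          linear_diff[OF linear_height] linear_cmul[OF linear_height])
      ultimately show ?thesis
        using A_cases by auto
    next
      case False
      then have less_v: "len (v @ gen I) < len v"
        using len_snoc_neq[OF v I] by simp
      define x where "x = v @ gen I"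
      have x: "x \<in> words S"
        using v I by (simp add: x_def)
      have vx: "(v, x @ gen I) \<in> weyl_cong"
        using pres_cong.sym[OF cong_left[OF square_cong[OF I] v]] by (simp add: x_def)
      have len_v: "len v = len x + 1"
        using len_append_le[OF x, of "gen I"] len_cong[OF vx] less_v I by (simp add: x_def)
      have "(v @ gen J @ gen I, x @ gen I @ gen J @ gen I) \<in> weyl_cong"
        using cong_right[OF vx, of "gen J @ gen I"] I J by simp
      with uI have uxI: "(u @ gen I, x @ gen I @ gen J @ gen I) \<in> weyl_cong"
        by (rule pres_cong.trans)
      show ?thesis
        using A_cases
      proof
        assume orth: "A J I = 0"
        have "(gen I @ gen J @ gen I, gen I @ gen I @ gen J) \<in> weyl_cong"
          using cong_left[OF commute_cong[OF J I \<open>J \<noteq> I\<close> orth], of "gen I"] I by simp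
        also have "(gen I @ gen I @ gen J, gen J) \<in> weyl_cong"
          using cong_right[OF square_cong[OF I], of "gen J"] J by simp
        finally have "(x @ gen I @ gen J @ gen I, x @ gen J) \<in> weyl_cong"
          using x by (rule cong_left)
        with uxI have "(u @ gen I, x @ gen J) \<in> weyl_cong"
          by (rule pres_cong.trans)
        then have "len (u @ gen I) \<le> len x + 1"
          using len_cong[of "u @ gen I" "x @ gen J"] len_append_le[OF x, of "gen J"] J by simp
        then show ?thesis
          using less.prems(3) len_u len_v by simp
      next
        assume adj: "A J I = -1"
        then have adj': "A I J = -1"
          using cartan_sym[OF I J] by simp
        have "act u (root I) = act x (refl I (refl J (root I)))"
          using act_cong[OF vx] by (simp add: act_u)
        also have "refl I (refl J (root I)) = root J"
          by (simp add: refl_root[OF J I] adj adj' linear_add[OF linear_refl] refl_root[OF I J]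
            refl_root_self[OF I])
        finally have act_x: "act u (root I) = act x (root J)" .
        have "(x @ gen I @ gen J @ gen I, (x @ gen J) @ gen I @ gen J) \<in> weyl_cong"
          using cong_left[OF braid_cong[OF I J not_sym[OF \<open>J \<noteq> I\<close>] adj'] x] by simp
        with uxI have "(u @ gen I, (x @ gen J) @ gen I @ gen J) \<in> weyl_cong"
          by (rule pres_cong.trans)
        then have "len (u @ gen I) \<le> len (x @ gen J) + 2"
          using len_cong[of "u @ gen I" "(x @ gen J) @ gen I @ gen J"]
            len_append_le[of "x @ gen J" "gen I @ gen J"] x I J by simp
        then have "len x < len (x @ gen J)"
          using less.prems(3) len_u len_v by simp
        then show ?thesis
          using less.hyps[OF _ x J] len_u len_v by (simp add: act_x)
      qed
    qed
  qed
qed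

text \<open>A last letter \<open>I\<close> of a reduced word makes the word send the root of \<open>I\<close> to a negative vector, which
the identity does not do.\<close>

lemma act_trivial:
  assumes "u \<in> words S" "\<And>x. act u x = x"
  shows "(u, []) \<in> weyl_cong"
proof (cases "len u = 0")
  case True
  then show ?thesis
    by (auto intro: len_reduced[OF assms(1)])
next
  case False
  then have "len u > 0" by simp
  then obtain v I where v: "v \<in> words S" "I \<in> S" "(u, v @ gen I) \<in> weyl_cong"
    "len u = len v + 1"
    by (rule reduced_last[OF assms(1)])
  have "height (act v (root I)) > 0"
    using height_act_root_pos[OF v(1,2)] len_cong[OF v(3)] v(4) by simp
  moreover have "root I = - act v (root I)"
    using assms(2)[of "root I"] act_cong[OF v(3)]
    by (simp add: refl_root_self[OF v(2)] linear_neg[OF linear_act])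
  then have "height (root I) = - height (act v (root I))"
    using linear_neg[OF linear_height, of "act v (root I)"] by simp
  ultimately show ?thesis
    using height_root[OF v(2)] by simp
qed

lemma act_eq_iff:
  assumes "u \<in> words S" "v \<in> words S"
  shows "act u = act v \<longleftrightarrow> (u, v) \<in> weyl_cong"
proof
  assume eq: "act u = act v"
  let ?v = "map (apsnd Not) (rev v)"
  have v: "?v \<in> words S"
    using assms(2) by (rule words_inverse)
  have inv: "(v @ ?v, []) \<in> weyl_cong"
    using pres_cong_inverse[OF v] by (simp only: inverse_word_involution)
  have "act (u @ ?v) x = x" for x
    using fun_cong[OF act_cong[OF inv], of x] eq by simp
  then have "(u @ ?v, []) \<in> weyl_cong"
    using assms v by (intro act_trivial) simp_all
  then show "(u, v) \<in> weyl_cong"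
    using inv by (rule cong_common_inverse)
next
  assume "(u, v) \<in> weyl_cong"
  then show "act u = act v" by (rule act_cong)
qed

end

section \<open>Hermitian quaternionic matrices and the simple roots\<close>

instantiation quat :: real_vector
begin

definition scaleR_quat :: "real \<Rightarrow> quat \<Rightarrow> quat" where
  "scaleR_quat r q = Quat (r * qRe q) (r * qIm1 q) (r * qIm2 q) (r * qIm3 q)"

instance
  by standard (simp_all add: scaleR_quat_def plus_quat_def algebra_simps)

end

lemma quat_sel [simp]:
  "qRe 0 = 0" "qIm1 0 = 0" "qIm2 0 = 0" "qIm3 0 = 0"
  "qRe 1 = 1" "qIm1 1 = 0" "qIm2 1 = 0" "qIm3 1 = 0"
  "qRe (p + q) = qRe p + qRe q" "qIm1 (p + q) = qIm1 p + qIm1 q"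
  "qIm2 (p + q) = qIm2 p + qIm2 q" "qIm3 (p + q) = qIm3 p + qIm3 q"
  "qRe (p - q) = qRe p - qRe q" "qIm1 (p - q) = qIm1 p - qIm1 q"
  "qIm2 (p - q) = qIm2 p - qIm2 q" "qIm3 (p - q) = qIm3 p - qIm3 q"
  "qRe (- p) = - qRe p" "qIm1 (- p) = - qIm1 p"
  "qIm2 (- p) = - qIm2 p" "qIm3 (- p) = - qIm3 p"
  "qRe (r *\<^sub>R p) = r * qRe p" "qIm1 (r *\<^sub>R p) = r * qIm1 p"
  "qIm2 (r *\<^sub>R p) = r * qIm2 p" "qIm3 (r *\<^sub>R p) = r * qIm3 p"
  "qRe (qcnj p) = qRe p" "qIm1 (qcnj p) = - qIm1 p"
  "qIm2 (qcnj p) = - qIm2 p" "qIm3 (qcnj p) = - qIm3 p"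
  "qRe (p * q) = qRe p * qRe q - qIm1 p * qIm1 q - qIm2 p * qIm2 q - qIm3 p * qIm3 q"
  "qIm1 (p * q) = qRe p * qIm1 q + qIm1 p * qRe q + qIm2 p * qIm3 q - qIm3 p * qIm2 q"
  "qIm2 (p * q) = qRe p * qIm2 q - qIm1 p * qIm3 q + qIm2 p * qRe q + qIm3 p * qIm1 q"
  "qIm3 (p * q) = qRe p * qIm3 q + qIm1 p * qIm2 q - qIm2 p * qIm1 q + qIm3 p * qRe q"
  by (simp_all add: zero_quat_def one_quat_def plus_quat_def minus_quat_def uminus_quat_def
    scaleR_quat_def times_quat_def qcnj_def)

lemma quat_eq_iff:
  "p = q \<longleftrightarrow> qRe p = qRe q \<and> qIm1 p = qIm1 q \<and> qIm2 p = qIm2 q \<and> qIm3 p = qIm3 q"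
  by (cases p; cases q) auto

definition qreal :: "real \<Rightarrow> quat" where
  "qreal r = r *\<^sub>R 1"

lemma qreal_sel [simp]:
  "qRe (qreal r) = r" "qIm1 (qreal r) = 0" "qIm2 (qreal r) = 0" "qIm3 (qreal r) = 0"
  by (simp_all add: qreal_def)

definition qnorm :: "quat \<Rightarrow> real" where
  "qnorm q = (qRe q)\<^sup>2 + (qIm1 q)\<^sup>2 + (qIm2 q)\<^sup>2 + (qIm3 q)\<^sup>2"

lemma qnorm_mult: "qnorm (p * q) = qnorm p * qnorm q"
  by (simp add: qnorm_def power2_eq_square algebra_simps)

lemma qnorm_nonneg: "qnorm q \<ge> 0"
  by (simp add: qnorm_def)

lemma qnorm_eq_0: "qnorm q = 0 \<longleftrightarrow> q = 0"
  by (auto simp: qnorm_def quat_eq_iff add_nonneg_eq_0_iff)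

lemma mult_qcnj: "q * qcnj q = qreal (qnorm q)" and qcnj_mult_self: "qcnj q * q = qreal (qnorm q)"
  by (simp_all add: quat_eq_iff qnorm_def power2_eq_square algebra_simps)

lemma qreal_1 [simp]: "qreal 1 = 1"
  by (simp add: qreal_def)

lemma qnorm_qcnj [simp]: "qnorm (qcnj q) = qnorm q"
  by (simp add: qnorm_def)

lemma qcnj_qcnj [simp]: "qcnj (qcnj q) = q"
  by (simp add: quat_eq_iff)

lemma qcnj_mult: "qcnj (p * q) = qcnj q * qcnj p"
  by (simp add: quat_eq_iff algebra_simps)

lemma qcnj_add: "qcnj (p + q) = qcnj p + qcnj q"
  by (simp add: quat_eq_iff)

lemma qcnj_uminus: "qcnj (- p) = - qcnj p"
  by (simp add: quat_eq_iff)

definition mat2 :: "'a \<Rightarrow> 'a \<Rightarrow> 'a \<Rightarrow> 'a \<Rightarrow> 'a^2^2" where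
  "mat2 a b c d = (\<chi> i j. if i = 1 then (if j = 1 then a else b) else (if j = 1 then c else d))"

lemma mat2_nth [simp]:
  "mat2 a b c d $ 1 $ 1 = a" "mat2 a b c d $ 1 $ 2 = b"
  "mat2 a b c d $ 2 $ 1 = c" "mat2 a b c d $ 2 $ 2 = d"
  by (simp_all add: mat2_def)

lemma mat2_eq_iff:
  "S = T \<longleftrightarrow> S $ 1 $ 1 = T $ 1 $ 1 \<and> S $ 1 $ 2 = T $ 1 $ 2 \<and> S $ 2 $ 1 = T $ 2 $ 1
    \<and> S $ 2 $ 2 = T $ 2 $ 2"
  for S T :: "'a^2^2"
  by (auto simp: vec_eq_iff forall_2)

lemma mat2_cases: obtains a b c d where "S = mat2 a b c d"
proof -
  have "S = mat2 (S $ 1 $ 1) (S $ 1 $ 2) (S $ 2 $ 1) (S $ 2 $ 2)"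
    by (simp add: mat2_eq_iff)
  then show ?thesis using that by blast
qed

lemma mat2_mult [simp]:
  "mat2 a b c d ** mat2 a' b' c' d'
    = mat2 (a * a' + b * c') (a * b' + b * d') (c * a' + d * c') (c * b' + d * d')"
  by (simp add: mat2_eq_iff matrix_matrix_mult_def sum_2)

lemma mat_1_mat2: "mat 1 = mat2 1 0 0 1"
  by (simp add: mat2_eq_iff mat_def)

lemma uminus_mat2 [simp]: "- mat2 a b c d = mat2 (- a) (- b) (- c) (- d)"
  by (simp add: mat2_eq_iff)

lemma ctranspose_mat2 [simp]:
  "ctranspose (mat2 a b c d) = mat2 (qcnj a) (qcnj c) (qcnj b) (qcnj d)"
  by (simp add: mat2_eq_iff ctranspose_def)

lemma ctranspose_mult: "ctranspose (S ** T) = ctranspose T ** ctranspose S"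
  by (cases S rule: mat2_cases; cases T rule: mat2_cases) (simp add: qcnj_mult qcnj_add)

type_synonym hvec = "real \<times> real \<times> quat"

definition herm :: "hvec \<Rightarrow> quat^2^2" where
  "herm v = (case v of (p, r, z) \<Rightarrow> mat2 (qreal p) z (qcnj z) (qreal r))"

text \<open>The symmetric bilinear form for which \<open>lorentz_form v v\<close> is minus twice the determinant of
\<open>herm v\<close>.\<close>

definition lorentz_form :: "hvec \<Rightarrow> hvec \<Rightarrow> real" where
  "lorentz_form v w = (case v of (p, r, z) \<Rightarrow> case w of (p', r', z') \<Rightarrow>
    2 * (qRe z * qRe z' + qIm1 z * qIm1 z' + qIm2 z * qIm2 z' + qIm3 z * qIm3 z')
      - p * r' - r * p')"

text \<open>Simple roots of \<open>D\<^sub>4\<close> among the Hurwitz units: the three imaginary units are the outer nodes, and the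
central node is chosen so that its double plus \<open>i + j + k\<close>, the highest root, equals 1.\<close>

definition simple_unit :: "int \<Rightarrow> quat" where
  "simple_unit I =
    (if I = 1 then Quat (1 / 2) (- 1 / 2) (- 1 / 2) (- 1 / 2)
     else if I = 2 then Quat 0 1 0 0
     else if I = 3 then Quat 0 0 1 0
     else Quat 0 0 0 1)"

text \<open>The affine node carries minus the highest root plus a null vector, the over-extended node
the difference of two null vectors.\<close>

definition simple_root :: "int \<Rightarrow> hvec" where
  "simple_root I =
    (if I = -1 then (1, -1, 0) else if I = 0 then (-1, 0, -1) else (0, 0, simple_unit I))"

text \<open>The linear functional with value 1 on every simple root.\<close>

definition height :: "hvec \<Rightarrow> real" where
  "height v = (case v of (p, r, z) \<Rightarrow>
    5 * qRe z + qIm1 z + qIm2 z + qIm3 z - 6 * p - 7 * r)"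

lemma D4pp_node_cases:
  assumes "I \<in> D4pp_nodes"
  obtains "I = -1" | "I = 0" | "I = 1" | "I = 2" | "I = 3" | "I = 4"
  using assms by (auto simp: D4pp_nodes_def)

interpretation D4pp: simply_laced_roots D4pp_nodes D4pp_cartan lorentz_form simple_root height
proof (rule simply_laced_roots.intro)
  show "linear (lorentz_form x)" for x
    by (rule linearI) (auto simp: lorentz_form_def algebra_simps split: prod.split)
  show "lorentz_form x y = lorentz_form y x" for x y
    by (simp add: lorentz_form_def split: prod.split)
  show "lorentz_form (simple_root I) (simple_root J) = of_int (D4pp_cartan I J)"
    if "I \<in> D4pp_nodes" "J \<in> D4pp_nodes" for I J
    using that(1) by (rule D4pp_node_cases; use that(2) in \<open>rule D4pp_node_cases\<close>)
      (simp_all add: lorentz_form_def simple_root_def simple_unit_def D4pp_cartan_def D4pp_edges_def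
        doubleton_eq_iff)
  show "D4pp_cartan I I = 2" for I
    by (simp add: D4pp_cartan_def)
  show "D4pp_cartan I J = 0 \<or> D4pp_cartan I J = -1" if "I \<noteq> J" for I J
    using that by (simp add: D4pp_cartan_def)
  show "linear height"
    by (rule linearI) (auto simp: height_def algebra_simps split: prod.split)
  show "height (simple_root I) > 0" if "I \<in> D4pp_nodes" for I
    using that by (rule D4pp_node_cases) (simp_all add: height_def simple_root_def simple_unit_def)
qed

text \<open>The action \<open>X \<mapsto> S X S\<^sup>\<dagger>\<close> on Hermitian matrices, as a relation: both directions are needed, from
matrices to maps and from Weyl group elements to the matrices that realize them.\<close>

definition induces :: "quat^2^2 \<Rightarrow> (hvec \<Rightarrow> hvec) \<Rightarrow> bool" where
  "induces S g \<longleftrightarrow> (\<forall>v. herm (g v) = S ** herm v ** ctranspose S)"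

lemma herm_inject: "herm v = herm w \<longleftrightarrow> v = w"
  by (auto simp: herm_def mat2_eq_iff quat_eq_iff split: prod.split)

lemma induces_comp: "induces S g \<Longrightarrow> induces T h \<Longrightarrow> induces (S ** T) (g \<circ> h)"
  unfolding induces_def by (simp del: split_paired_All add: ctranspose_mult matrix_mul_assoc)

lemma induces_unique: "induces S g \<Longrightarrow> induces S h \<Longrightarrow> g = h"
  by (metis induces_def herm_inject ext)

lemma mat2_herm:
  "mat2 a b c d ** herm (p, r, z) ** ctranspose (mat2 a b c d) =
    herm (p * qnorm a + 2 * qRe (a * z * qcnj b) + r * qnorm b,
      p * qnorm c + 2 * qRe (c * z * qcnj d) + r * qnorm d,
      p *\<^sub>R (a * qcnj c) + a * z * qcnj d + b * qcnj z * qcnj c + r *\<^sub>R (b * qcnj d))"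
  by (simp add: herm_def mat2_eq_iff) 
    (simp add: quat_eq_iff qnorm_def power2_eq_square algebra_simps)

lemma induces_mat2_iff:
  "induces (mat2 a b c d) g \<longleftrightarrow> (\<forall>p r z. g (p, r, z) = 
    (p * qnorm a + 2 * qRe (a * z * qcnj b) + r * qnorm b,
      p * qnorm c + 2 * qRe (c * z * qcnj d) + r * qnorm d,
      p *\<^sub>R (a * qcnj c) + a * z * qcnj d + b * qcnj z * qcnj c + r *\<^sub>R (b * qcnj d)))"
  by (simp only: induces_def split_paired_All mat2_herm herm_inject)

lemma uminus_mult_ctranspose: "- S ** M ** ctranspose (- S) = S ** M ** ctranspose S"
  by (cases S rule: mat2_cases; cases M rule: mat2_cases)
    (simp add: qcnj_uminus algebra_simps)

lemma induces_uminus: "induces (- S) g \<longleftrightarrow> induces S g"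
  by (simp only: induces_def uminus_mult_ctranspose)

text \<open>Fixing the two diagonal idempotents makes \<open>S\<close> diagonal with unit entries \<open>a\<close>, \<open>d\<close>. Fixing the
off-diagonal vector of \<open>z = 1\<close> then gives \<open>a = d\<close>, and fixing those of all \<open>z\<close> puts \<open>a\<close> in the centre.\<close>

lemma induces_id_imp:
  assumes "induces S id"
  shows "S = mat 1 \<or> S = - mat 1"
proof -
  obtain a b c d where S: "S = mat2 a b c d" by (rule mat2_cases)
  note * = assms[unfolded S induces_mat2_iff, rule_format]
  have a: "qnorm a = 1" and "qnorm c = 0"
    using *[of 1 0 0] by (simp_all add: qnorm_eq_0)
  moreover have "qnorm b = 0" and d: "qnorm d = 1"
    using *[of 0 1 0] by (simp_all add: qnorm_eq_0)
  ultimately have [simp]: "b = 0" "c = 0"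
    by (simp_all add: qnorm_eq_0)
  have comm: "a * z * qcnj d = z" for z
    using *[of 0 0 z] by simp
  have "a = a * qcnj d * d"
    using d by (simp add: mult.assoc qcnj_mult_self)
  then have "a = d"
    using comm[of 1] by simp
  have az: "a * z = z * a" for z
  proof -
    have "a * z * qcnj d * d = z * d"
      using comm[of z] by simp
    then show ?thesis
      using d \<open>a = d\<close> by (simp add: mult.assoc qcnj_mult_self)
  qed
  have "qIm1 a = 0" "qIm2 a = 0" "qIm3 a = 0"
    using az[of "Quat 0 1 0 0"] az[of "Quat 0 0 1 0"] by (auto simp: quat_eq_iff)
  moreover from this have "(qRe a)\<^sup>2 = 1"
    using a by (simp add: qnorm_def)
  ultimately have "a = 1 \<or> a = -1"
    by (auto simp: quat_eq_iff power2_eq_1_iff)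
  then show ?thesis
    using \<open>a = d\<close> by (auto simp: S mat_1_mat2)
qed

section \<open>Hurwitz integers modulo the commutator ideal\<close>

lemma hurwitz_diff: "p \<in> hurwitz \<Longrightarrow> q \<in> hurwitz \<Longrightarrow> p - q \<in> hurwitz"
  using hurwitz_add[of p "- q"] hurwitz_uminus by simp

lemma hurwitz_qcnj:
  assumes "q \<in> hurwitz"
  shows "qcnj q \<in> hurwitz"
proof -
  obtain s a b c d :: int
    where q: "q = Quat (s / 2 + a) (s / 2 + b) (s / 2 + c) (s / 2 + d)"
    using assms unfolding hurwitz_iff by blast
  show ?thesis
    unfolding hurwitz_iff
    by (rule exI[of _ s], rule exI[of _ a], rule exI[of _ "- s - b"],
        rule exI[of _ "- s - c"], rule exI[of _ "- s - d"])
      (simp add: q qcnj_def field_simps)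
qed

lemma qnorm_hurwitz:
  assumes "q \<in> hurwitz"
  obtains n :: nat where "qnorm q = real n"
proof -
  obtain s a b c d :: int
    where q: "q = Quat (s / 2 + a) (s / 2 + b) (s / 2 + c) (s / 2 + d)"
    using assms unfolding hurwitz_iff by blast
  let ?m = "s^2 + s * (a + b + c + d) + a^2 + b^2 + c^2 + d^2"
  have "qnorm q = of_int ?m"
    by (simp add: q qnorm_def power2_eq_square field_simps)
  then have "qnorm q = real (nat ?m)"
    using qnorm_nonneg[of q] by (metis of_int_0_le_iff of_nat_nat)
  then show ?thesis by (rule that)
qed

text \<open>The coordinates of a Hurwitz integer are all integral or all half-integral, so the real part tells
which of the two is the case.\<close>

lemma hurwitz_Re_int:
  assumes "q \<in> hurwitz" "qRe q \<in> \<int>"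
  shows "qIm1 q \<in> \<int>" "qIm2 q \<in> \<int>" "qIm3 q \<in> \<int>"
proof -
  have "(1 / 2 :: real) \<notin> \<int>"
  proof
    assume "(1 / 2 :: real) \<in> \<int>"
    then obtain n :: int where "(1 / 2 :: real) = of_int n" by (auto elim: Ints_cases)
    then have "2 * n = 1" by linarith
    then show False by presburger
  qed
  moreover have "1 / 2 = qRe q - (qRe q - 1 / 2)" by simp
  ultimately have "qRe q - 1 / 2 \<notin> \<int>"
    using assms(2) Ints_diff by metis
  then show "qIm1 q \<in> \<int>" "qIm2 q \<in> \<int>" "qIm3 q \<in> \<int>"
    using assms(1) by (auto simp: hurwitz_def)
qed

text \<open>Rounding the coordinates of \<open>a / c\<close> leaves an error of norm at most 1, with equality only if all
four errors are one half; in that case \<open>a / c\<close> is itself a Hurwitz integer.\<close>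

lemma hurwitz_division:
  assumes "a \<in> hurwitz" "c \<noteq> 0"
  obtains q where "q \<in> hurwitz" "qnorm (a - q * c) < qnorm c"
proof -
  define x where "x = (1 / qnorm c) *\<^sub>R (a * qcnj c)"
  have "qnorm c > 0"
    using assms(2) qnorm_nonneg[of c] qnorm_eq_0[of c] by linarith
  have "x * c = (1 / qnorm c) *\<^sub>R (a * (qcnj c * c))"
    by (simp add: x_def quat_eq_iff algebra_simps)
  also have "\<dots> = a"
    using \<open>qnorm c > 0\<close> unfolding qcnj_mult_self by (simp add: quat_eq_iff)
  finally have x: "x * c = a" .
  have "\<exists>q\<in>hurwitz. qnorm (x - q) < 1"
  proof -
    define q where "q = Quat (round (qRe x)) (round (qIm1 x)) (round (qIm2 x)) (round (qIm3 x))"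
    have q: "q \<in> hurwitz"
      by (simp add: q_def hurwitz_def)
    have bound: "(t - round t)\<^sup>2 \<le> 1 / 4" for t :: real
    proof -
      have "\<bar>t - round t\<bar> \<le> 1 / 2"
        using of_int_round_abs_le[of t] by (simp add: abs_minus_commute)
      then have "\<bar>t - round t\<bar>\<^sup>2 \<le> (1 / 2)\<^sup>2"
        by (intro power_mono) auto
      then show ?thesis by (simp add: power2_eq_square)
    qed
    show ?thesis
    proof (cases "qnorm (x - q) < 1")
      case True
      then show ?thesis using q by blast
    next
      case False
      have half: "t - 1 / 2 \<in> \<int>" if "(t - round t)\<^sup>2 = 1 / 4" for t :: real
      proof -
        have "(t - round t)\<^sup>2 = (1 / 2)\<^sup>2"
          using that by (simp add: power2_eq_square)
        then have "t - round t = 1 / 2 \<or> t - round t = - 1 / 2"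
          unfolding power2_eq_iff by simp
        then have "t - 1 / 2 = of_int (round t) \<or> t - 1 / 2 = of_int (round t - 1)"
          by auto
        then show ?thesis by (metis Ints_of_int)
      qed
      have "(qRe x - round (qRe x))\<^sup>2 = 1 / 4" "(qIm1 x - round (qIm1 x))\<^sup>2 = 1 / 4"
        "(qIm2 x - round (qIm2 x))\<^sup>2 = 1 / 4" "(qIm3 x - round (qIm3 x))\<^sup>2 = 1 / 4"
        using False bound[of "qRe x"] bound[of "qIm1 x"] bound[of "qIm2 x"] bound[of "qIm3 x"]
        by (simp_all add: qnorm_def q_def)
      then have "x \<in> hurwitz"
        by (simp add: hurwitz_def half)
      then show ?thesis by (intro bexI[of _ x]) (simp_all add: qnorm_def)
    qed
  qed
  then obtain q where q: "q \<in> hurwitz" "qnorm (x - q) < 1" by blast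
  have "a - q * c = (x - q) * c"
    by (simp add: x algebra_simps)
  then have "qnorm (a - q * c) < qnorm c"
    using q(2) \<open>qnorm c > 0\<close> by (simp add: qnorm_mult)
  with q(1) show ?thesis by (rule that)
qed

lemma ideal_commutator_ideal: "ideal commutator_ideal hurwitz_ring"
  unfolding commutator_ideal_def
  by (rule ring.genideal_ideal[OF ring_hurwitz_ring])
    (auto simp: hurwitz_ring_def intro: hurwitz_diff hurwitz_mult)

lemma commutator_ideal_commutator:
  "a \<in> hurwitz \<Longrightarrow> b \<in> hurwitz \<Longrightarrow> a * b - b * a \<in> commutator_ideal"
  unfolding commutator_ideal_def
  by (rule subsetD[OF ring.genideal_self[OF ring_hurwitz_ring]])
    (auto simp: hurwitz_ring_def intro: hurwitz_diff hurwitz_mult)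

lemma commutator_ideal_add:
  "x \<in> commutator_ideal \<Longrightarrow> y \<in> commutator_ideal \<Longrightarrow> x + y \<in> commutator_ideal"
  using additive_subgroup.a_closed[OF ideal.axioms(1)[OF ideal_commutator_ideal]]
  by (simp add: hurwitz_ring_def)

lemma commutator_ideal_mult:
  "x \<in> commutator_ideal \<Longrightarrow> a \<in> hurwitz \<Longrightarrow> a * x \<in> commutator_ideal"
  "x \<in> commutator_ideal \<Longrightarrow> a \<in> hurwitz \<Longrightarrow> x * a \<in> commutator_ideal"
  using ideal.I_l_closed[OF ideal_commutator_ideal] ideal.I_r_closed[OF ideal_commutator_ideal]
  by (simp_all add: hurwitz_ring_def)

text \<open>The right ideal generated by \<open>1 + i\<close> is two-sided, since conjugation by \<open>1 + i\<close> permutes the imaginary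
units up to sign and so preserves the Hurwitz integers; and it contains all commutators.\<close>

lemma commutator_ideal_subset: "commutator_ideal \<subseteq> (\<lambda>h. Quat 1 1 0 0 * h) ` hurwitz"
proof -
  let ?p = "Quat 1 1 0 0"
  let ?L = "(\<lambda>h. ?p * h) ` hurwitz"
  have p: "?p \<in> hurwitz"
    by (simp add: hurwitz_def)
  have conj: "\<exists>h'\<in>hurwitz. h * ?p = ?p * h'" if "h \<in> hurwitz" for h
  proof (rule bexI)
    show "h * ?p = ?p * Quat (qRe h) (qIm1 h) (qIm3 h) (- qIm2 h)"
      by (simp add: quat_eq_iff)
    obtain s a b c d :: int
      where h: "h = Quat (s / 2 + a) (s / 2 + b) (s / 2 + c) (s / 2 + d)"
      using \<open>h \<in> hurwitz\<close> unfolding hurwitz_iff by blast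
    show "Quat (qRe h) (qIm1 h) (qIm3 h) (- qIm2 h) \<in> hurwitz"
      unfolding hurwitz_iff
      by (rule exI[of _ s], rule exI[of _ a], rule exI[of _ b], rule exI[of _ d],
        rule exI[of _ "- s - c"]) (simp add: h field_simps)
  qed
  have "ideal ?L hurwitz_ring"
  proof (rule idealI[OF ring_hurwitz_ring])
    show "subgroup ?L (add_monoid hurwitz_ring)"
    proof (rule group.subgroupI)
      show "group (add_monoid hurwitz_ring)"
        using ring_hurwitz_ring abelian_group.a_group ring_def by blast
      show "?L \<noteq> {}" using p by auto
      show "inv\<^bsub>add_monoid hurwitz_ring\<^esub> x \<in> ?L" if "x \<in> ?L" for x
      proof -
        obtain h where h: "x = ?p * h" "h \<in> hurwitz" using \<open>x \<in> ?L\<close> by blast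
        have "inv\<^bsub>add_monoid hurwitz_ring\<^esub> x = ?p * (- h)"
          using h p
          by (intro group.inv_equality[OF abelian_group.a_group[OF ring.is_abelian_group[OF ring_hurwitz_ring]]])
            (auto simp: hurwitz_ring_def hurwitz_mult hurwitz_uminus)
        then show ?thesis using h hurwitz_uminus by blast
      qed
      show "x \<otimes>\<^bsub>add_monoid hurwitz_ring\<^esub> y \<in> ?L" if "x \<in> ?L" "y \<in> ?L" for x y
        using that by (auto simp: hurwitz_ring_def hurwitz_add simp flip: distrib_left)
    qed (use p in \<open>auto simp: hurwitz_ring_def hurwitz_mult\<close>)
    show "x \<otimes>\<^bsub>hurwitz_ring\<^esub> a \<in> ?L" if "a \<in> ?L" "x \<in> carrier hurwitz_ring" for a x
    proof -
      obtain h where h: "a = ?p * h" "h \<in> hurwitz" using \<open>a \<in> ?L\<close> by blast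
      have x: "x \<in> hurwitz" using that by (simp add: hurwitz_ring_def)
      then obtain x' where x': "x' \<in> hurwitz" "x * ?p = ?p * x'" using conj by blast
      have "x * a = ?p * (x' * h)"
        using x'(2) by (simp add: h(1) flip: mult.assoc)
      then show ?thesis
        using x' h hurwitz_mult by (simp add: hurwitz_ring_def)
    qed
    show "a \<otimes>\<^bsub>hurwitz_ring\<^esub> x \<in> ?L" if "a \<in> ?L" "x \<in> carrier hurwitz_ring" for a x
      using that by (auto simp: hurwitz_ring_def mult.assoc hurwitz_mult)
  qed
  moreover have "a * b - b * a \<in> ?L" if "a \<in> hurwitz" "b \<in> hurwitz" for a b
  proof -
    obtain s a0 a1 a2 a3 t b0 b1 b2 b3 :: int
      where a: "a = Quat (s / 2 + a0) (s / 2 + a1) (s / 2 + a2) (s / 2 + a3)"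
        and b: "b = Quat (t / 2 + b0) (t / 2 + b1) (t / 2 + b2) (t / 2 + b3)"
      using \<open>a \<in> hurwitz\<close> \<open>b \<in> hurwitz\<close> unfolding hurwitz_iff by blast
    let ?c = "a * b - b * a"
    \<comment> \<open>\<open>?h\<close> is the product of the commutator with \<open>(1 - i) / 2\<close>, the inverse of \<open>1 + i\<close>. Half the
      commutator is purely imaginary, with coordinates that are integral after doubling and have
      integral sum; this makes the coordinates of \<open>?h\<close> congruent modulo 1.\<close>
    let ?h = "Quat (qIm1 ?c / 2) (qIm1 ?c / 2) ((qIm2 ?c + qIm3 ?c) / 2) ((qIm3 ?c - qIm2 ?c) / 2)"
    have "?c = ?p * ?h"
      by (simp add: quat_eq_iff field_simps)
    moreover have "?h \<in> hurwitz"
      unfolding hurwitz_iff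
      by (rule exI[of _ "s * (b3 - b2) + t * (a2 - a3)"],
          rule exI[of _ "a2 * b3 - a3 * b2"], rule exI[of _ "a2 * b3 - a3 * b2"],
          rule exI[of _ "a3 * b1 - a1 * b3 + a1 * b2 - a2 * b1 + s * (b2 - b3) + t * (a3 - a2)"],
          rule exI[of _ "a1 * b2 - a2 * b1 - a3 * b1 + a1 * b3 + s * (b2 - b1) + t * (a1 - a2)"])
        (simp add: a b field_simps)
    ultimately show ?thesis by blast
  qed
  then have "{a * b - b * a |a b. a \<in> hurwitz \<and> b \<in> hurwitz} \<subseteq> ?L"
    by blast
  ultimately show ?thesis
    unfolding commutator_ideal_def by (intro ring.genideal_minimal[OF ring_hurwitz_ring])
qed

text \<open>Hence a unit congruent to 1 modulo the commutator ideal has integral coordinates, which leaves only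
the eight elements of the quaternion group.\<close>

lemma commutator_ideal_Re_int:
  assumes "q \<in> commutator_ideal"
  shows "qRe q \<in> \<int>"
proof -
  obtain h where h: "q = Quat 1 1 0 0 * h" "h \<in> hurwitz"
    using assms commutator_ideal_subset by blast
  then obtain s a b c d :: int
    where "h = Quat (s / 2 + a) (s / 2 + b) (s / 2 + c) (s / 2 + d)"
    unfolding hurwitz_iff by blast
  then have "qRe q = of_int (a - b)"
    by (simp add: h(1))
  then show ?thesis by (metis Ints_of_int)
qed

definition qdet :: "quat^2^2 \<Rightarrow> quat" where
  "qdet S = S $ 1 $ 1 * S $ 2 $ 2 - S $ 1 $ 2 * S $ 2 $ 1"

text \<open>Over a noncommutative ring \<open>a d - b c\<close> is not multiplicative, but it becomes so modulo the commutator
ideal.\<close>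

definition hurwitz_det_one :: "(quat^2^2) set" where
  "hurwitz_det_one = {S. (\<forall>i j. S $ i $ j \<in> hurwitz) \<and> qdet S - 1 \<in> commutator_ideal}"

lemma hurwitz_det_one_mat2:
  "mat2 a b c d \<in> hurwitz_det_one \<longleftrightarrow> a \<in> hurwitz \<and> b \<in> hurwitz \<and> c \<in> hurwitz \<and> d \<in> hurwitz
    \<and> a * d - b * c - 1 \<in> commutator_ideal"
  by (auto simp: hurwitz_det_one_def qdet_def forall_2)

text \<open>The determinant of the product minus the product of the determinants is a sum of multiples of
commutators.\<close>

lemma hurwitz_det_one_mult:
  assumes "S \<in> hurwitz_det_one" "T \<in> hurwitz_det_one"
  shows "S ** T \<in> hurwitz_det_one"
proof -
  obtain a b c d where S: "S = mat2 a b c d" by (rule mat2_cases)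
  obtain a' b' c' d' where T: "T = mat2 a' b' c' d'" by (rule mat2_cases)
  let ?K = "\<lambda>x y. x * y - y * x"
  have hurw [simp]: "a \<in> hurwitz" "b \<in> hurwitz" "c \<in> hurwitz" "d \<in> hurwitz"
    "a' \<in> hurwitz" "b' \<in> hurwitz" "c' \<in> hurwitz" "d' \<in> hurwitz"
    and det: "a * d - b * c - 1 \<in> commutator_ideal" "a' * d' - b' * c' - 1 \<in> commutator_ideal"
    using assms by (simp_all add: S T hurwitz_det_one_mat2)
  \<comment> \<open>Each commutator swaps two neighbouring factors, or products of factors, in one of the monomials.\<close>
  have eq: "(a * a' + b * c') * (c * b' + d * d') - (a * b' + b * d') * (c * a' + d * c') - 1
    = a * ?K a' (c * b') + a * (?K c b' * a') + b * ?K c' (c * b') + a * (?K a' d * d')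
      + b * ?K c' (d * d') + b * (?K d d' * c') + a * (?K d b' * c') + b * ?K (c * a') d'
      + (a * d - b * c - 1) * (a' * d' - b' * c') + (a' * d' - b' * c' - 1)"
    by (simp add: algebra_simps)
  have "\<dots> \<in> commutator_ideal"
    by (intro commutator_ideal_add commutator_ideal_mult commutator_ideal_commutator
      hurwitz_mult hurwitz_diff det hurw)
  then show ?thesis
    unfolding S T mat2_mult hurwitz_det_one_mat2 eq by (simp add: hurwitz_mult hurwitz_add)
qed

section \<open>Matrices that induce even Weyl group elements\<close>

definition positive_word :: "'i list \<Rightarrow> 'i word" where
  "positive_word Is = map (\<lambda>I. (I, False)) Is"

lemma positive_word_simps [simp]:
  "positive_word [] = []" "positive_word (I # Is) = (I, False) # positive_word Is"
  "positive_word (Is @ Js) = positive_word Is @ positive_word Js"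
  by (simp_all add: positive_word_def)

lemma positive_word_words: "Is \<in> lists S \<Longrightarrow> positive_word Is \<in> words S"
  by (induction Is) (auto simp: words_def)

abbreviation weyl_act :: "int list \<Rightarrow> hvec \<Rightarrow> hvec" where
  "weyl_act Is \<equiv> D4pp.act (positive_word Is)"

lemma weyl_act_append: "weyl_act (Is @ Js) = weyl_act Is \<circ> weyl_act Js"
  by (simp add: fun_eq_iff)

lemma weyl_act_rev: "Is \<in> lists D4pp_nodes \<Longrightarrow> weyl_act (rev Is) (weyl_act Is v) = v"
  by (induction Is arbitrary: v) (auto simp: D4pp.refl_refl)

text \<open>The reflection in the vector \<open>(0, 0, 1)\<close>, the highest root of \<open>D\<^sub>4\<close>.\<close>

definition sigma :: "hvec \<Rightarrow> hvec" where
  "sigma v = (case v of (p, r, z) \<Rightarrow> (p, r, - qcnj z))"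

text \<open>The reflections of the nodes 1, 2, 3, 4 move the simple root of node 1 to the highest root, so
conjugating that of node 1 by their product gives \<open>sigma\<close>.\<close>

definition sigma_word :: "int list" where
  "sigma_word = [1, 2, 3, 4, 1, 4, 3, 2, 1]"

text \<open>For a unit \<open>u\<close> the reflection in \<open>(0, 0, u)\<close> maps \<open>z\<close> to \<open>- u * qcnj z * u\<close>. Its product with
\<open>sigma\<close> is therefore \<open>z \<mapsto> u * z * u\<close>, the action of the diagonal matrix of \<open>u\<close> and \<open>qcnj u\<close>.
For the over-extended node the product exchanges the two null directions, and for the affine node it
is the translation by 1.\<close>

definition refl_sigma_matrix :: "int \<Rightarrow> quat^2^2" where
  "refl_sigma_matrix I = (if I = -1 then mat2 0 1 (-1) 0 else if I = 0 then mat2 1 1 0 1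
    else mat2 (simple_unit I) 0 0 (qcnj (simple_unit I)))"

text \<open>The inverses of the matrices \<open>refl_sigma_matrix\<close>.\<close>

definition sigma_refl_matrix :: "int \<Rightarrow> quat^2^2" where
  "sigma_refl_matrix I = (if I = -1 then mat2 0 (-1) 1 0 else if I = 0 then mat2 1 (-1) 0 1
    else mat2 (qcnj (simple_unit I)) 0 0 (simple_unit I))"

lemma refl_expand:
  "D4pp.refl I (p, r, z) = (p, r, z) - lorentz_form (p, r, z) (simple_root I) *\<^sub>R simple_root I"
  by (simp add: D4pp.refl_def)

lemmas refl_compute = refl_expand lorentz_form_def simple_root_def simple_unit_def

lemma weyl_act_sigma_word: "weyl_act sigma_word = sigma"
proof
  fix v :: hvec
  obtain p r z where v: "v = (p, r, z)" by (cases v)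
  have r1: "D4pp.refl 1 (p, r, z) = (p, r, Quat
    ((qRe z + qIm1 z + qIm2 z + qIm3 z) / 2) ((qRe z + qIm1 z - qIm2 z - qIm3 z) / 2)
    ((qRe z - qIm1 z + qIm2 z - qIm3 z) / 2) ((qRe z - qIm1 z - qIm2 z + qIm3 z) / 2))" for p r z
    by (simp add: refl_compute quat_eq_iff field_simps)
  have r234: "D4pp.refl 2 (p, r, z) = (p, r, Quat (qRe z) (- qIm1 z) (qIm2 z) (qIm3 z))"
    "D4pp.refl 3 (p, r, z) = (p, r, Quat (qRe z) (qIm1 z) (- qIm2 z) (qIm3 z))"
    "D4pp.refl 4 (p, r, z) = (p, r, Quat (qRe z) (qIm1 z) (qIm2 z) (- qIm3 z))" for p r z
    by (simp_all add: refl_compute quat_eq_iff)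
  show "weyl_act sigma_word v = sigma v"
    by (simp add: v sigma_word_def sigma_def r1 r234 quat_eq_iff field_simps)
qed

lemma induces_refl_sigma_matrix:
  assumes "I \<in> D4pp_nodes"
  shows "induces (refl_sigma_matrix I) (D4pp.refl I \<circ> sigma)"
  using assms
  by (rule D4pp_node_cases)
    (simp_all add: refl_sigma_matrix_def induces_mat2_iff refl_compute sigma_def qnorm_def
      quat_eq_iff power2_eq_square field_simps)

lemma induces_sigma_refl_matrix:
  assumes "I \<in> D4pp_nodes"
  shows "induces (sigma_refl_matrix I) (sigma \<circ> D4pp.refl I)"
  using assms
  by (rule D4pp_node_cases)
    (simp_all add: sigma_refl_matrix_def induces_mat2_iff refl_compute sigma_def qnorm_def
      quat_eq_iff power2_eq_square field_simps)

lemma simple_unit_hurwitz: "simple_unit I \<in> hurwitz"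
  by (simp add: simple_unit_def hurwitz_def)

lemma zero_commutator_ideal: "0 \<in> commutator_ideal"
  using commutator_ideal_commutator[OF hurwitz_one hurwitz_one] by simp

lemma qnorm_simple_unit: "qnorm (simple_unit I) = 1"
  by (simp add: simple_unit_def qnorm_def power2_eq_square)

lemma refl_sigma_matrix_hurwitz_det_one:
  "refl_sigma_matrix I \<in> hurwitz_det_one" "sigma_refl_matrix I \<in> hurwitz_det_one"
  by (simp_all add: refl_sigma_matrix_def sigma_refl_matrix_def hurwitz_det_one_mat2 hurwitz_zero
    hurwitz_one
    hurwitz_uminus hurwitz_qcnj simple_unit_hurwitz mult_qcnj qcnj_mult_self qnorm_simple_unit
    zero_commutator_ideal)

lemma induces_mat_1: "induces (mat 1) id"
  by (simp add: mat_1_mat2 induces_mat2_iff qnorm_def quat_eq_iff)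

text \<open>Letters are taken in pairs: \<open>r\<^sub>I r\<^sub>J = (r\<^sub>I sigma) (sigma r\<^sub>J)\<close>.\<close>

lemma even_word_induces:
  assumes "Is \<in> lists D4pp_nodes" "even (length Is)"
  shows "\<exists>S\<in>hurwitz_det_one. induces S (weyl_act Is)"
  using assms
proof (induction Is rule: induct_list012)
  case 1
  have "mat 1 \<in> hurwitz_det_one"
    by (simp add: mat_1_mat2 hurwitz_det_one_mat2 hurwitz_zero hurwitz_one zero_commutator_ideal)
  then show ?case
    using induces_mat_1 by (auto simp: id_def D4pp.act_def)
next
  case (2 I)
  then show ?case by simp
next
  case (3 I J Is)
  then obtain S where S: "S \<in> hurwitz_det_one" "induces S (weyl_act Is)" by auto
  have "(D4pp.refl I \<circ> sigma) \<circ> (sigma \<circ> D4pp.refl J) \<circ> weyl_act Is = weyl_act (I # J # Is)"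
    by (auto simp: fun_eq_iff sigma_def qcnj_uminus split: prod.split)
  moreover have "induces (refl_sigma_matrix I ** sigma_refl_matrix J ** S)
      ((D4pp.refl I \<circ> sigma) \<circ> (sigma \<circ> D4pp.refl J) \<circ> weyl_act Is)"
    using 3 S(2) by (intro induces_comp induces_refl_sigma_matrix induces_sigma_refl_matrix) auto
  moreover have "refl_sigma_matrix I ** sigma_refl_matrix J ** S \<in> hurwitz_det_one"
    by (intro hurwitz_det_one_mult refl_sigma_matrix_hurwitz_det_one S(1))
  ultimately show ?case by metis
qed

definition even_image :: "(quat^2^2) set" where
  "even_image = {S. \<exists>Is\<in>lists D4pp_nodes. even (length Is) \<and> induces S (weyl_act Is)}"

lemma even_image_mult:
  assumes "S \<in> even_image" "T \<in> even_image"
  shows "S ** T \<in> even_image"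
proof -
  obtain Is Js where "Is \<in> lists D4pp_nodes" "even (length Is)" "induces S (weyl_act Is)"
    "Js \<in> lists D4pp_nodes" "even (length Js)" "induces T (weyl_act Js)"
    using assms by (auto simp: even_image_def)
  then show ?thesis
    unfolding even_image_def using induces_comp[of S "weyl_act Is" T "weyl_act Js"]
    by (auto simp flip: weyl_act_append intro!: bexI[of _ "Is @ Js"])
qed

text \<open>A left inverse of \<open>S\<close> undoes the action of \<open>S\<close> on the range of that action, which is everything.\<close>

lemma induces_inverse:
  assumes "induces S g" "T ** S = mat 1" "\<And>v. g (h v) = v"
  shows "induces T h"
  unfolding induces_def
proof
  fix v
  have "T ** herm v ** ctranspose T = T ** herm (g (h v)) ** ctranspose T"
    by (simp add: assms(3))
  also have "\<dots> = (T ** S) ** herm (h v) ** ctranspose (T ** S)"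
    using assms(1) by (simp add: induces_def ctranspose_mult matrix_mul_assoc del: split_paired_All)
  also have "\<dots> = herm (h v)"
    using induces_mat_1 by (simp add: assms(2) induces_def del: split_paired_All)
  finally show "herm (h v) = T ** herm v ** ctranspose T" ..
qed

lemma even_image_inverse:
  assumes "S \<in> even_image" "T ** S = mat 1"
  shows "T \<in> even_image"
proof -
  obtain Is where Is: "Is \<in> lists D4pp_nodes" "even (length Is)" "induces S (weyl_act Is)"
    using assms by (auto simp: even_image_def)
  then have rev: "rev Is \<in> lists D4pp_nodes"
    by (simp add: in_lists_conv_set)
  have "induces T (weyl_act (rev Is))"
    using weyl_act_rev[OF rev] by (intro induces_inverse[OF Is(3) assms(2)]) simp
  then show ?thesis
    using Is(2) rev unfolding even_image_def by (auto intro!: bexI[of _ "rev Is"])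
qed

text \<open>As \<open>sigma_word\<close> has odd length, a letter followed by it is an even word.\<close>

lemma refl_sigma_matrix_even_image:
  assumes "I \<in> D4pp_nodes"
  shows "refl_sigma_matrix I \<in> even_image"
proof -
  have "weyl_act (I # sigma_word) = D4pp.refl I \<circ> sigma"
    by (simp add: fun_eq_iff weyl_act_sigma_word)
  then show ?thesis
    unfolding even_image_def using induces_refl_sigma_matrix[OF assms] assms
    by (auto intro!: bexI[of _ "I # sigma_word"]) (auto simp: sigma_word_def D4pp_nodes_def)
qed

section \<open>Diagonal and unipotent matrices\<close>

abbreviation qi :: quat where "qi \<equiv> Quat 0 1 0 0"
abbreviation qj :: quat where "qj \<equiv> Quat 0 0 1 0"
abbreviation qk :: quat where "qk \<equiv> Quat 0 0 0 1"
text \<open>The unit of the central node, of order 6.\<close>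

abbreviation qeps :: quat where "qeps \<equiv> Quat (1 / 2) (- 1 / 2) (- 1 / 2) (- 1 / 2)"

definition qdiag :: "quat \<Rightarrow> quat \<Rightarrow> quat^2^2" where
  "qdiag a d = mat2 a 0 0 d"

definition qtrans :: "quat \<Rightarrow> quat^2^2" where
  "qtrans q = mat2 1 q 0 1"

definition quaternion_units :: "quat set" where
  "quaternion_units = {1, -1, qi, - qi, qj, - qj, qk, - qk}"

lemma qdiag_mult_even_image:
  "qdiag a d \<in> even_image \<Longrightarrow> qdiag a' d' \<in> even_image \<Longrightarrow> qdiag (a * a') (d * d') \<in> even_image"
  using even_image_mult[of "qdiag a d" "qdiag a' d'"] by (simp add: qdiag_def)

lemma qdiag_inverse_even_image:
  assumes "qdiag a d \<in> even_image" "qnorm a = 1" "qnorm d = 1"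
  shows "qdiag (qcnj a) (qcnj d) \<in> even_image"
  by (rule even_image_inverse[OF assms(1)])
    (simp add: qdiag_def mat_1_mat2 qcnj_mult_self assms)

lemma qdiag_basic_even_image:
  "qdiag qi (- qi) \<in> even_image" "qdiag qj (- qj) \<in> even_image" "qdiag qk (- qk) \<in> even_image"
  "qdiag qeps (qcnj qeps) \<in> even_image"
  using refl_sigma_matrix_even_image[of 1] refl_sigma_matrix_even_image[of 2]
    refl_sigma_matrix_even_image[of 3] refl_sigma_matrix_even_image[of 4]
  by (simp_all add: refl_sigma_matrix_def simple_unit_def qdiag_def qcnj_def uminus_quat_def
    D4pp_nodes_def)

lemma qdiag_neg_one_even_image: "qdiag (-1) (-1) \<in> even_image"
proof -
  have "mat 1 \<in> even_image"
    using induces_mat_1 unfolding even_image_def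
    by (auto simp: id_def D4pp.act_def intro!: bexI[of _ "[]"])
  then show ?thesis
    unfolding even_image_def using induces_uminus[of "mat 1"]
    by (simp add: qdiag_def mat_1_mat2)
qed

text \<open>The product of the pairs \<open>(i, -i)\<close>, \<open>(j, -j)\<close>, \<open>(k, -k)\<close> is \<open>(-1, 1)\<close>, hence \<open>(i, i)\<close> and \<open>(j, j)\<close>
are available. Conjugation by \<open>(qeps, qcnj qeps)\<close> rotates the imaginary units in opposite senses in the
two components, so it separates them: \<open>(i, i)\<close> becomes \<open>(k, j)\<close>, and dividing by \<open>(k, -k)\<close> leaves a pair
with first component 1.\<close>

lemma qdiag_quaternion_units_even_image:
  assumes "e \<in> quaternion_units"
  shows "qdiag 1 e \<in> even_image" "qdiag e 1 \<in> even_image"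
proof -
  note mult = qdiag_mult_even_image and basic = qdiag_basic_even_image
  note compute = times_quat_def uminus_quat_def one_quat_def qcnj_def
  have m1: "qdiag (-1) 1 \<in> even_image"
    using mult[OF mult[OF basic(1,2)] basic(3)] by (simp add: compute)
  have eps': "qdiag (qcnj qeps) qeps \<in> even_image"
    using qdiag_inverse_even_image[OF basic(4)] by (simp add: qnorm_def power2_eq_square)
  have ii: "qdiag qi qi \<in> even_image" and jj: "qdiag qj qj \<in> even_image"
    using mult[OF mult[OF m1 basic(1)] qdiag_neg_one_even_image]
      mult[OF mult[OF m1 basic(2)] qdiag_neg_one_even_image] by (simp_all add: compute)
  have kk: "qdiag (- qk) qk \<in> even_image" and ii': "qdiag (- qi) qi \<in> even_image"
    using mult[OF basic(3) qdiag_neg_one_even_image] mult[OF basic(1) qdiag_neg_one_even_image]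
    by (simp_all add: compute)
  have i: "qdiag 1 (- qi) \<in> even_image"
    using mult[OF kk mult[OF mult[OF basic(4) ii] eps']] by (simp add: compute)
  have j: "qdiag 1 (- qj) \<in> even_image"
    using mult[OF ii' mult[OF mult[OF basic(4) jj] eps']] by (simp add: compute)
  have k: "qdiag 1 qk \<in> even_image"
    using mult[OF i j] by (simp add: compute)
  have m: "qdiag 1 (-1) \<in> even_image"
    using mult[OF i i] by (simp add: compute)
  have 1: "qdiag 1 1 \<in> even_image"
    using mult[OF m m] by (simp add: compute)
  have right: "qdiag 1 e \<in> even_image" if "e \<in> quaternion_units" for e
    using that i j k m 1 mult[OF i m] mult[OF j m] mult[OF k m]
    by (auto simp: quaternion_units_def compute)
  then show "qdiag 1 e \<in> even_image" using assms .
  have "qdiag qi 1 \<in> even_image" "qdiag qj 1 \<in> even_image" "qdiag qk 1 \<in> even_image"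
    using mult[OF basic(1) right[of qi]] mult[OF basic(2) right[of qj]] mult[OF basic(3) right[of qk]]
    by (simp_all add: compute quaternion_units_def)
  then show "qdiag e 1 \<in> even_image"
    using assms m1 1 mult[OF m1, of qi 1] mult[OF m1, of qj 1] mult[OF m1, of qk 1]
    by (auto simp: quaternion_units_def compute)
qed

lemma quaternion_unitsI:
  assumes "e \<in> hurwitz" "qnorm e = 1" "qRe e \<in> \<int>"
  shows "e \<in> quaternion_units"
proof -
  obtain a b c d :: int where e: "qRe e = a" "qIm1 e = b" "qIm2 e = c" "qIm3 e = d"
    using assms(3) hurwitz_Re_int[OF assms(1,3)] by (auto elim!: Ints_cases)
  have "real_of_int (a\<^sup>2 + b\<^sup>2 + c\<^sup>2 + d\<^sup>2) = 1"
    using assms(2) by (simp add: qnorm_def e)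
  then have sum: "a\<^sup>2 + b\<^sup>2 + c\<^sup>2 + d\<^sup>2 = 1"
    by linarith
  have sq: "n\<^sup>2 = 0 \<and> n = 0 \<or> n\<^sup>2 = 1 \<and> (n = 1 \<or> n = -1) \<or> n\<^sup>2 > 1" for n :: int
  proof -
    have "n\<^sup>2 = 0 \<or> n\<^sup>2 = 1 \<or> n\<^sup>2 > 1"
      using zero_le_power2[of n] by linarith
    then show ?thesis
      by (auto simp: power2_eq_1_iff)
  qed
  have "e = Quat a b c d"
    by (simp add: quat_eq_iff e)
  then show ?thesis
    using sum sq[of a] sq[of b] sq[of c] sq[of d]
    by (elim disjE conjE; simp add: quaternion_units_def one_quat_def uminus_quat_def)
qed

text \<open>The quaternion group has index 3 in the group of Hurwitz units, and \<open>qeps\<close> represents a generator of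
the quotient. For a unit with half-integral coordinates, the parity of a sum of its coordinates decides
whether \<open>qeps\<close> or its conjugate makes the product integral.\<close>

lemma quaternion_units_mult_qcnj:
  assumes "a \<in> hurwitz" "qnorm a = 1"
  shows "\<exists>m\<in>{1, qeps, qcnj qeps}. a * qcnj m \<in> quaternion_units"
proof -
  have eps: "qeps \<in> hurwitz" "qcnj qeps \<in> hurwitz" "qnorm qeps = 1"
    using simple_unit_hurwitz[of 1] qnorm_simple_unit[of 1] hurwitz_qcnj by (simp_all add: simple_unit_def)
  show ?thesis
  proof (cases "qRe a \<in> \<int>")
    case True
    have "a * qcnj 1 = a"
      by (simp add: quat_eq_iff)
    then have "a * qcnj 1 \<in> quaternion_units"
      using quaternion_unitsI[OF assms True] by simp
    then show ?thesis by blast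
  next
    case False
    then obtain a0 a1 a2 a3 :: int where "qRe a - 1 / 2 = a0" "qIm1 a - 1 / 2 = a1"
      "qIm2 a - 1 / 2 = a2" "qIm3 a - 1 / 2 = a3"
      using assms(1) by (auto simp: hurwitz_def elim!: Ints_cases)
    then have a: "qRe a = a0 + 1 / 2" "qIm1 a = a1 + 1 / 2" "qIm2 a = a2 + 1 / 2" "qIm3 a = a3 + 1 / 2"
      by simp_all
    show ?thesis
    proof (cases "even (a0 - a1 - a2 - a3 - 1)")
      case True
      then obtain n where "a0 - a1 - a2 - a3 - 1 = 2 * n" by (rule evenE)
      then have "qRe (a * qcnj qeps) = of_int n"
        by (simp add: a field_simps)
      then have "a * qcnj qeps \<in> quaternion_units"
        using eps assms by (intro quaternion_unitsI) (simp_all add: hurwitz_mult qnorm_mult)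
      then show ?thesis by blast
    next
      case False
      then obtain n where "a0 + a1 + a2 + a3 + 2 = 2 * n"
        by (metis (no_types) evenE even_add even_diff odd_one even_numeral)
      then have "qRe (a * qeps) = of_int n"
        by (simp add: a field_simps)
      then have "a * qcnj (qcnj qeps) \<in> quaternion_units"
        using eps assms by (intro quaternion_unitsI) (simp_all add: hurwitz_mult qnorm_mult)
      then show ?thesis by blast
    qed
  qed
qed

lemma quaternion_units_qcnj: "e \<in> quaternion_units \<Longrightarrow> qcnj e \<in> quaternion_units"
  by (auto simp: quaternion_units_def quat_eq_iff)

lemma quaternion_units_qnorm: "e \<in> quaternion_units \<Longrightarrow> qnorm e = 1"
  by (auto simp: quaternion_units_def qnorm_def)

text \<open>With \<open>a = q m\<close>, \<open>q\<close> in the quaternion group and \<open>m\<close> a power of \<open>qeps\<close>, the pair \<open>(a, d)\<close> is the product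
of \<open>(q, 1)\<close>, \<open>(m, qcnj m)\<close>, \<open>(1, qcnj q)\<close> and \<open>(1, a d)\<close>; the last entry is a unit congruent to 1, hence in
the quaternion group.\<close>

lemma qdiag_even_image:
  assumes "a \<in> hurwitz" "d \<in> hurwitz" "qnorm a = 1" "qnorm d = 1" "a * d - 1 \<in> commutator_ideal"
  shows "qdiag a d \<in> even_image"
proof -
  obtain m where m: "m \<in> {1, qeps, qcnj qeps}" and q: "a * qcnj m \<in> quaternion_units"
    using quaternion_units_mult_qcnj[OF assms(1,3)] by blast
  have norm_m: "qnorm m = 1"
    using m qnorm_simple_unit[of 1] by (auto simp: simple_unit_def qnorm_def)
  have m_image: "qdiag m (qcnj m) \<in> even_image"
    using m qdiag_basic_even_image(4) qdiag_inverse_even_image[OF qdiag_basic_even_image(4)]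
      qdiag_quaternion_units_even_image(1)[of 1]
    by (auto simp: quaternion_units_def qnorm_def power2_eq_square one_quat_def qcnj_def)
  have "qRe (a * d) = qRe (a * d - 1) + 1" by simp
  then have "qRe (a * d) \<in> \<int>"
    using commutator_ideal_Re_int[OF assms(5)] by (metis Ints_1 Ints_add)
  then have ad: "a * d \<in> quaternion_units"
    using assms by (intro quaternion_unitsI) (simp_all add: hurwitz_mult qnorm_mult)
  define q where "q = a * qcnj m"
  have a: "q * m = a"
    using norm_m by (simp add: q_def mult.assoc qcnj_mult_self)
  have "qcnj m * (qcnj q * (a * d)) = qcnj (q * m) * a * d"
    by (simp add: qcnj_mult mult.assoc)
  also have "\<dots> = d"
    using assms(3) by (simp add: a qcnj_mult_self)
  finally have d: "qcnj m * (qcnj q * (a * d)) = d" .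
  have "qdiag q 1 \<in> even_image" "qdiag 1 (qcnj q) \<in> even_image" "qdiag 1 (a * d) \<in> even_image"
    using q ad qdiag_quaternion_units_even_image quaternion_units_qcnj unfolding q_def by blast+
  then have "qdiag (q * m * (1 * 1)) (1 * qcnj m * (qcnj q * (a * d))) \<in> even_image"
    by (intro qdiag_mult_even_image m_image)
  then show ?thesis
    using a d by simp
qed

lemma qtrans_add_even_image:
  "qtrans p \<in> even_image \<Longrightarrow> qtrans q \<in> even_image \<Longrightarrow> qtrans (p + q) \<in> even_image"
  using even_image_mult[of "qtrans p" "qtrans q"] by (simp add: qtrans_def add.commute)

lemma qtrans_uminus_even_image: "qtrans q \<in> even_image \<Longrightarrow> qtrans (- q) \<in> even_image"
  by (erule even_image_inverse) (simp add: qtrans_def mat_1_mat2)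

lemma qtrans_scale_even_image:
  assumes "qtrans q \<in> even_image"
  shows "qtrans (of_int n *\<^sub>R q) \<in> even_image"
proof (induction n rule: int_induct[of _ 0])
  case base
  then show ?case
    using qtrans_add_even_image[OF assms qtrans_uminus_even_image[OF assms]] by simp
next
  case (step1 n)
  then show ?case
    using qtrans_add_even_image[OF step1(2) assms] by (simp add: scaleR_add_left)
next
  case (step2 n)
  then show ?case
    using qtrans_add_even_image[OF step2(2) qtrans_uminus_even_image[OF assms]]
    by (simp add: scaleR_diff_left)
qed

lemma qtrans_conjugate_even_image:
  assumes "qdiag a d \<in> even_image" "qnorm a = 1" "qnorm d = 1" "qtrans q \<in> even_image"
  shows "qtrans (a * q * qcnj d) \<in> even_image"
proof -
  have "qdiag a d ** qtrans q ** qdiag (qcnj a) (qcnj d) = qtrans (a * q * qcnj d)"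
    using assms(2,3) by (simp add: qdiag_def qtrans_def mult_qcnj)
  then show ?thesis
    using even_image_mult[OF even_image_mult[OF assms(1,4)] qdiag_inverse_even_image[OF assms(1-3)]]
    by simp
qed

text \<open>Conjugating the translation by 1, which belongs to the affine node, with diagonal matrices gives the
translations by the quaternion units and by a half-integral unit; together these generate the Hurwitz
integers additively.\<close>

lemma qtrans_even_image:
  assumes "q \<in> hurwitz"
  shows "qtrans q \<in> even_image"
proof -
  have one: "qtrans 1 \<in> even_image"
    using refl_sigma_matrix_even_image[of 0] by (simp add: qtrans_def refl_sigma_matrix_def D4pp_nodes_def)
  have units: "qtrans e \<in> even_image" if "e \<in> quaternion_units" for e
    using qtrans_conjugate_even_image[OF qdiag_quaternion_units_even_image(2)[OF that] _ _ one]
      quaternion_units_qnorm[OF that] by (simp add: qnorm_def qcnj_def one_quat_def[symmetric])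
  define w where "w = Quat (1 / 2) (1 / 2) (1 / 2) (1 / 2)"
  have "qtrans (qeps * 1 * qcnj (qcnj qeps)) \<in> even_image"
    using qtrans_conjugate_even_image[OF qdiag_basic_even_image(4) _ _ one]
    by (simp add: qnorm_def power2_eq_square)
  moreover have "qeps * 1 * qcnj (qcnj qeps) = - w"
    by (simp add: w_def quat_eq_iff)
  ultimately have w: "qtrans w \<in> even_image"
    using qtrans_uminus_even_image by fastforce
  obtain s a b c d :: int
    where q: "q = Quat (s / 2 + a) (s / 2 + b) (s / 2 + c) (s / 2 + d)"
    using assms unfolding hurwitz_iff by blast
  have "q = of_int s *\<^sub>R w + of_int a *\<^sub>R 1 + of_int b *\<^sub>R qi + of_int c *\<^sub>R qj + of_int d *\<^sub>R qk"
    by (simp add: q w_def quat_eq_iff)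
  also have "qtrans \<dots> \<in> even_image"
    by (intro qtrans_add_even_image qtrans_scale_even_image w one units)
      (simp_all add: quaternion_units_def)
  finally show ?thesis .
qed

section \<open>Euclidean descent and the isomorphism\<close>

lemma herm_det_herm: "herm_det (herm v) = qreal (- lorentz_form v v / 2)"
  by (simp add: herm_det_def herm_def lorentz_form_def split: prod.split)
    (simp add: quat_eq_iff field_simps)

lemma mult_ctranspose_eq_herm:
  "mat2 a b c d ** ctranspose (mat2 a b c d)
    = herm (qnorm a + qnorm b, qnorm c + qnorm d, a * qcnj c + b * qcnj d)"
  by (simp add: herm_def mat2_eq_iff mult_qcnj)
    (simp add: qreal_def scaleR_add_left quat_eq_iff)

text \<open>Weyl group elements preserve the form, hence the determinant of Hermitian matrices. This replaces the
general multiplicativity of the quaternionic determinant.\<close>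

lemma herm_det_even_image_mult:
  assumes "S \<in> even_image"
  shows "herm_det ((S ** T) ** ctranspose (S ** T)) = herm_det (T ** ctranspose T)"
proof -
  obtain Is where Is: "Is \<in> lists D4pp_nodes" "induces S (weyl_act Is)"
    using assms by (auto simp: even_image_def)
  obtain v where v: "T ** ctranspose T = herm v"
    using mult_ctranspose_eq_herm by (metis mat2_cases)
  have "(S ** T) ** ctranspose (S ** T) = herm (weyl_act Is v)"
    using Is(2) by (simp add: induces_def ctranspose_mult matrix_mul_assoc v[symmetric]
      del: split_paired_All)
  then show ?thesis
    using D4pp.form_act[OF positive_word_words[OF Is(1)], of v v] by (simp add: v herm_det_herm)
qed

lemma herm_det_even_image:
  assumes "S \<in> even_image"
  shows "herm_det (S ** ctranspose S) = 1"
proof -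
  have "herm_det ((S ** mat 1) ** ctranspose (S ** mat 1)) = herm_det (mat 1 ** ctranspose (mat 1))"
    using assms by (rule herm_det_even_image_mult)
  then show ?thesis
    by (simp add: herm_det_def) (simp add: mat_1_mat2 quat_eq_iff)
qed

lemma herm_det_mat2_lower_zero:
  "herm_det (mat2 a b 0 d ** ctranspose (mat2 a b 0 d)) = qreal (qnorm a * qnorm d)"
  unfolding mult_ctranspose_eq_herm
  by (simp add: herm_det_herm)
    (simp add: quat_eq_iff lorentz_form_def qnorm_def power2_eq_square field_simps)

text \<open>Induction on the norm of the lower left entry \<open>c\<close>. If \<open>c \<noteq> 0\<close>, division with remainder of \<open>a\<close> by \<open>c\<close>
and exchanging the rows make it smaller. If \<open>c = 0\<close>, the norms of \<open>a\<close> and \<open>d\<close> have product 1, so both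
are units, and the matrix is the product of a unipotent and a diagonal one.\<close>

lemma hurwitz_det_one_even_image:
  assumes "S \<in> hurwitz_det_one" "herm_det (S ** ctranspose S) = 1"
  shows "S \<in> even_image"
proof -
  obtain n where "qnorm (S $ 2 $ 1) = real n"
    using assms(1) qnorm_hurwitz by (metis (mono_tags, lifting) hurwitz_det_one_def mem_Collect_eq)
  then show ?thesis
    using assms
  proof (induction n arbitrary: S rule: less_induct)
    case (less n)
    obtain a b c d where S: "S = mat2 a b c d" by (rule mat2_cases)
    have hurw: "a \<in> hurwitz" "b \<in> hurwitz" "c \<in> hurwitz" "d \<in> hurwitz"
      and det: "a * d - b * c - 1 \<in> commutator_ideal"
      using less.prems(2) by (simp_all add: S hurwitz_det_one_mat2)
    show ?case
    proof (cases "c = 0")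
      case True
      have "qnorm a * qnorm d = 1"
        using less.prems(3)[unfolded S True herm_det_mat2_lower_zero] by (simp add: quat_eq_iff)
      moreover obtain k l where "qnorm a = real k" "qnorm d = real l"
        using qnorm_hurwitz hurw by metis
      ultimately have "real (k * l) = real 1" "qnorm a = real k" "qnorm d = real l"
        by simp_all
      then have norms: "qnorm a = 1" "qnorm d = 1"
        unfolding of_nat_eq_iff by simp_all
      have "qtrans (b * qcnj d) ** qdiag a d = S"
        using norms by (simp add: S True qtrans_def qdiag_def mult.assoc qcnj_mult_self)
      then show ?thesis
        using even_image_mult[of "qtrans (b * qcnj d)" "qdiag a d"] det hurw norms
        by (simp add: qtrans_even_image qdiag_even_image hurwitz_mult hurwitz_qcnj True)
    next
      case False
      obtain q where q: "q \<in> hurwitz" "qnorm (a - q * c) < qnorm c"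
        using hurwitz_division[OF hurw(1) False] .
      define J :: "quat^2^2" where "J = mat2 0 1 (-1) 0"
      define J' :: "quat^2^2" where "J' = mat2 0 (-1) 1 0"
      have J: "J \<in> even_image" "J' \<in> even_image"
        using refl_sigma_matrix_even_image[of "-1"] even_image_inverse[of J J']
        by (simp_all add: J_def J'_def mat_1_mat2 refl_sigma_matrix_def D4pp_nodes_def)
      define T where "T = J ** qtrans (- q) ** S"
      have entry: "T $ 2 $ 1 = - (a - q * c)"
        by (simp add: T_def J_def qtrans_def S)
      have G: "J ** qtrans (- q) \<in> even_image"
        by (intro even_image_mult J qtrans_even_image hurwitz_uminus q)
      have "J \<in> hurwitz_det_one" "qtrans (- q) \<in> hurwitz_det_one"
        using q(1) by (simp_all add: J_def qtrans_def hurwitz_det_one_mat2 hurwitz_zero hurwitz_one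
          hurwitz_uminus zero_commutator_ideal)
      then have T: "T \<in> hurwitz_det_one"
        unfolding T_def by (intro hurwitz_det_one_mult less.prems(2))
      then obtain m where m: "qnorm (T $ 2 $ 1) = real m"
        using qnorm_hurwitz by (metis (mono_tags, lifting) hurwitz_det_one_def mem_Collect_eq)
      have "qnorm (T $ 2 $ 1) = qnorm (a - q * c)"
        unfolding entry by (simp add: qnorm_def power2_commute)
      then have "m < n"
        using q(2) m less.prems(1) by (simp add: S)
      moreover have "herm_det (T ** ctranspose T) = 1"
        using herm_det_even_image_mult[OF G, of S] less.prems(3) by (simp add: T_def)
      ultimately have "T \<in> even_image"
        using less.IH[OF _ m T] by simp
      moreover have "qtrans q ** J' ** T = S"
        by (simp add: T_def S J_def J'_def qtrans_def algebra_simps)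
      ultimately show ?thesis
        using even_image_mult[OF even_image_mult[OF qtrans_even_image[OF q(1)] J(2)]] by metis
    qed
  qed
qed

text \<open>If \<open>S\<close> and \<open>T\<close> induce the same map and \<open>R\<close> induces its inverse, then \<open>R T\<close> and \<open>S R\<close> induce the
identity and are \<open>\<plusminus>1\<close>; associativity of \<open>S R T\<close> then gives \<open>T = \<plusminus>S\<close>.\<close>

lemma induces_eq_pm:
  assumes "S \<in> even_image" "induces S g"
  shows "{T. induces T g} = {S, - S}"
proof (intro equalityI subsetI)
  fix T assume "T \<in> {T. induces T g}"
  then have T: "induces T g" by simp
  obtain Is where Is: "Is \<in> lists D4pp_nodes" "even (length Is)" "induces S (weyl_act Is)"
    using assms(1) by (auto simp: even_image_def)
  then have g: "g = weyl_act Is"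
    using induces_unique assms(2) by blast
  have "rev Is \<in> lists D4pp_nodes" "even (length (rev Is))"
    using Is by (auto simp: in_lists_conv_set)
  then obtain R where R: "induces R (weyl_act (rev Is))"
    using even_word_induces by blast
  have RX: "R ** X = mat 1 \<or> R ** X = - mat 1" if "induces X g" for X
  proof (rule induces_id_imp)
    have "weyl_act (rev Is) \<circ> g = id"
      using weyl_act_rev[OF Is(1)] by (simp add: fun_eq_iff g)
    then show "induces (R ** X) id"
      using induces_comp[OF R that] by simp
  qed
  have SR: "S ** R = mat 1 \<or> S ** R = - mat 1"
  proof (rule induces_id_imp)
    have "g \<circ> weyl_act (rev Is) = id"
      using weyl_act_rev[OF \<open>rev Is \<in> _\<close>] by (simp add: fun_eq_iff g)
    then show "induces (S ** R) id"
      using induces_comp[OF assms(2) R] by simp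
  qed
  have neg: "- mat 1 ** X = - X" "X ** - mat 1 = - X" for X :: "quat^2^2"
    by (cases X rule: mat2_cases; simp add: mat_1_mat2)+
  have "S ** (R ** T) = (S ** R) ** T"
    by (simp add: matrix_mul_assoc)
  then have "S = T \<or> S = - T \<or> - S = T \<or> - S = - T"
    using RX[OF T] SR by (auto simp: neg)
  then show "T \<in> {S, - S}" by auto
next
  fix T assume "T \<in> {S, - S}"
  then show "T \<in> {T. induces T g}"
    using assms(2) induces_uminus by auto
qed

abbreviation weyl_class :: "int list \<Rightarrow> int word set" where
  "weyl_class Is \<equiv> D4pp.weyl_cong `` {positive_word Is}"

text \<open>The inverse of the double covering of a group of isometries by \<open>SL\<^sub>2\<close>: its values are pairs \<open>\<plusminus>S\<close>.
Quantifying over the words in a class avoids choosing a representative.\<close>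

definition spin :: "int word set \<Rightarrow> (quat^2^2) set" where
  "spin X = {S. \<exists>u\<in>X. induces S (D4pp.act u)}"

lemma foldr_weyl_gen:
  assumes "Is \<in> lists S"
  shows "foldr (mult (weyl_group S A)) (map (weyl_gen S A) Is) \<one>\<^bsub>weyl_group S A\<^esub>
    = pres_cong S (weyl_relators S A) `` {positive_word Is}"
  using assms
proof (induction Is)
  case Nil
  then show ?case by (simp add: weyl_group_def presented_group_def)
next
  case (Cons I Is)
  then have "positive_word [I] \<in> words S" "positive_word Is \<in> words S"
    using positive_word_words[of "[I]" S] positive_word_words[of Is S] by auto
  then show ?case
    using Cons presented_group_mult[of "positive_word [I]" S "positive_word Is" "weyl_relators S A"]
    by (simp add: weyl_gen_def pres_gen_def weyl_group_def)
qed

lemma carrier_even_weyl_group: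
  "carrier (even_weyl_group D4pp_nodes D4pp_cartan)
    = {weyl_class Is |Is. Is \<in> lists D4pp_nodes \<and> even (length Is)}"
proof -
  have "{foldr (mult (weyl_group S A)) (map (weyl_gen S A) Is) \<one>\<^bsub>weyl_group S A\<^esub> |Is.
      Is \<in> lists S \<and> even (length Is)}
    = {pres_cong S (weyl_relators S A) `` {positive_word Is} |Is. Is \<in> lists S \<and> even (length Is)}"
    for S :: "int set" and A
    by (rule Collect_cong) (metis foldr_weyl_gen)
  then show ?thesis
    by (simp add: even_weyl_group_def)
qed

lemma spin_weyl_class:
  assumes "Is \<in> lists D4pp_nodes"
  shows "spin (weyl_class Is) = {S. induces S (weyl_act Is)}"
proof -
  have "D4pp.act u = weyl_act Is" if "u \<in> weyl_class Is" for u
    using that D4pp.act_cong[of "positive_word Is" u] by simp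
  moreover have "positive_word Is \<in> weyl_class Is"
    using pres_cong.refl[OF positive_word_words[OF assms]] by simp
  ultimately have "(\<exists>u\<in>weyl_class Is. induces S (D4pp.act u)) \<longleftrightarrow> induces S (weyl_act Is)" for S
    by metis
  then show ?thesis
    by (simp only: spin_def)
qed

lemma spin_weyl_class_pm:
  assumes "Is \<in> lists D4pp_nodes" "even (length Is)"
  obtains S where "S \<in> hurwitz_det_one" "S \<in> even_image" "induces S (weyl_act Is)"
    "spin (weyl_class Is) = {S, - S}"
proof -
  obtain S where S: "S \<in> hurwitz_det_one" "induces S (weyl_act Is)"
    using even_word_induces[OF assms] by blast
  then have "S \<in> even_image"
    using assms by (auto simp: even_image_def)
  then show ?thesis
    using S by (intro that) (simp_all add: spin_weyl_class[OF assms(1)] induces_eq_pm)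
qed

lemma r_coset_pm: "{mat 1, - mat 1} #>\<^bsub>SL2_quat\<^esub> S = {S, - S}"
  by (cases S rule: mat2_cases) (auto simp: r_coset_def SL2_quat_def mat_1_mat2)

lemma carrier_PSL2_0_hurwitz:
  "carrier PSL2_0_hurwitz = {{S, - S} |S. S \<in> hurwitz_det_one \<and> herm_det (S ** ctranspose S) = 1}"
proof -
  have "qdet (- S) = qdet S" for S
    by (cases S rule: mat2_cases) (simp add: qdet_def)
  then have "(\<exists>T\<in>{S, - S}. qdet T - 1 \<in> commutator_ideal) \<longleftrightarrow> qdet S - 1 \<in> commutator_ideal" for S
    by simp
  then show ?thesis
    unfolding PSL2_0_hurwitz_def PSL2_hurwitz_def r_coset_pm hurwitz_det_one_def
    by (auto simp: SL2_quat_def qdet_def[symmetric])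
qed

lemma mult_PSL2_0_hurwitz:
  "{S, - S} \<otimes>\<^bsub>PSL2_0_hurwitz\<^esub> {T, - T} = {S ** T, - (S ** T)}"
proof -
  have "- S ** T = - (S ** T)" "S ** - T = - (S ** T)" "- S ** - T = S ** T"
    by (cases S rule: mat2_cases; cases T rule: mat2_cases; simp)+
  then show ?thesis
    by (auto simp: PSL2_0_hurwitz_def PSL2_hurwitz_def PSL2_quat_def FactGroup_def set_mult_def
      SL2_quat_def)
qed

theorem proposition9:
  shows "even_weyl_group D4pp_nodes D4pp_cartan \<cong> PSL2_0_hurwitz"
proof -
  let ?W = "even_weyl_group D4pp_nodes D4pp_cartan"
  have hom: "spin \<in> hom ?W PSL2_0_hurwitz"
  proof (rule homI)
    fix X assume "X \<in> carrier ?W"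
    then obtain Is where Is: "X = weyl_class Is" "Is \<in> lists D4pp_nodes" "even (length Is)"
      by (auto simp: carrier_even_weyl_group)
    obtain S where "S \<in> hurwitz_det_one" "S \<in> even_image" "spin X = {S, - S}"
      using spin_weyl_class_pm[OF Is(2,3)] Is(1) by blast
    then show "spin X \<in> carrier PSL2_0_hurwitz"
      using herm_det_even_image by (auto simp: carrier_PSL2_0_hurwitz)
  next
    fix X Y assume "X \<in> carrier ?W" "Y \<in> carrier ?W"
    then obtain Is Js where Is: "X = weyl_class Is" "Is \<in> lists D4pp_nodes" "even (length Is)"
      and Js: "Y = weyl_class Js" "Js \<in> lists D4pp_nodes" "even (length Js)"
      by (auto simp: carrier_even_weyl_group)
    obtain S where S: "S \<in> even_image" "induces S (weyl_act Is)" "spin X = {S, - S}"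
      using spin_weyl_class_pm[OF Is(2,3)] Is(1) by blast
    obtain T where T: "T \<in> even_image" "induces T (weyl_act Js)" "spin Y = {T, - T}"
      using spin_weyl_class_pm[OF Js(2,3)] Js(1) by blast
    have ST: "S ** T \<in> even_image" "induces (S ** T) (weyl_act (Is @ Js))"
      using even_image_mult[OF S(1) T(1)] induces_comp[OF S(2) T(2)]
      by (simp_all add: weyl_act_append del: positive_word_simps)
    have "X \<otimes>\<^bsub>?W\<^esub> Y = weyl_class (Is @ Js)"
      using presented_group_mult[OF positive_word_words[OF Is(2)] positive_word_words[OF Js(2)]]
      by (simp add: Is(1) Js(1) even_weyl_group_def weyl_group_def)
    also have "spin \<dots> = {S ** T, - (S ** T)}"
      using spin_weyl_class[of "Is @ Js"] Is(2) Js(2) induces_eq_pm[OF ST] by simp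
    finally show "spin (X \<otimes>\<^bsub>?W\<^esub> Y) = spin X \<otimes>\<^bsub>PSL2_0_hurwitz\<^esub> spin Y"
      by (simp add: S(3) T(3) mult_PSL2_0_hurwitz)
  qed
  have inj: "inj_on spin (carrier ?W)"
  proof (rule inj_onI)
    fix X Y assume XY: "X \<in> carrier ?W" "Y \<in> carrier ?W" and eq: "spin X = spin Y"
    from XY obtain Is Js where Is: "X = weyl_class Is" "Is \<in> lists D4pp_nodes" "even (length Is)"
      and Js: "Y = weyl_class Js" "Js \<in> lists D4pp_nodes" "even (length Js)"
      unfolding carrier_even_weyl_group by blast
    obtain S where S: "induces S (weyl_act Is)" "spin X = {S, - S}"
      using spin_weyl_class_pm[OF Is(2,3)] Is(1) by blast
    have "S \<in> spin Y"
      unfolding eq[symmetric] S(2) by simp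
    then have "induces S (weyl_act Js)"
      unfolding Js(1) spin_weyl_class[OF Js(2)] by simp
    with S(1) have "weyl_act Is = weyl_act Js"
      by (rule induces_unique)
    then have "(positive_word Is, positive_word Js) \<in> D4pp.weyl_cong"
      unfolding D4pp.act_eq_iff[OF positive_word_words[OF Is(2)] positive_word_words[OF Js(2)]] .
    then show "X = Y"
      unfolding Is(1) Js(1) by (rule equiv_class_eq[OF equiv_pres_cong])
  qed
  have surj: "carrier PSL2_0_hurwitz \<subseteq> spin ` carrier ?W"
  proof
    fix X assume "X \<in> carrier PSL2_0_hurwitz"
    then obtain S where X: "X = {S, - S}" and S: "S \<in> even_image"
      using hurwitz_det_one_even_image by (auto simp: carrier_PSL2_0_hurwitz)
    then obtain Is where Is: "Is \<in> lists D4pp_nodes" "even (length Is)" "induces S (weyl_act Is)"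
      by (auto simp: even_image_def)
    have "X = spin (weyl_class Is)"
      unfolding X spin_weyl_class[OF Is(1)] induces_eq_pm[OF S Is(3)] ..
    then show "X \<in> spin ` carrier ?W"
      using Is(1,2) unfolding carrier_even_weyl_group by blast
  qed
  have "spin ` carrier ?W = carrier PSL2_0_hurwitz"
    using hom_carrier[OF hom] surj by (rule subset_antisym)
  then have "bij_betw spin (carrier ?W) (carrier PSL2_0_hurwitz)"
    using inj by (intro bij_betw_imageI)
  with hom have "spin \<in> iso ?W PSL2_0_hurwitz"
    unfolding iso_def by (intro CollectI conjI)
  then show ?thesis
    by (rule is_isoI)
qed

end
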